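(* Let $W_7=\{(0,0,0),(1,1,1)\}$, $W_8=\{(0,0,1),(0,1,0),(1,0,0)\}$, $W_9=\{(0,0,0),(0,0,1),(0,1,0),(1,1,1)\}$, $W_{10}=\{(0,0,0),(0,0,1),(1,1,1)\}$ and $W_{12}=\{(0,0,0),(0,0,1),(0,1,0),(1,0,0)\}$, all subsets of $\{0,1\}^3$. Then the inducibility constants satisfy $\lambda(W_7)=1/3$, $\lambda(W_8)=2/3$, $\lambda(W_9)=4/9$, $\lambda(W_{10})=5/12$ and $\lambda(W_{12})=1/2$.
   Context: The $n$-hypercube $Q_n$ is the graph on $\{0,1\}^n$ in which two sequences are adjacent iff they differ in exactly one coordinate. A $d$-subcube of $\{0,1\}^n$ is a set $C\subseteq\{0,1\}^n$ obtained by fixing $n-d$ coordinates to constant values and letting the remaining $d$ coordinates vary arbitrarily; there are $\binom nd 2^{n-d}$ of them (equivalently, $C$ is a set whose induced subgraph $Q_n[C]$ is isomorphic to $Q_d$). For $H\subseteq\{0,1\}^d$ and $S\subseteq\{0,1\}^n$, a $d$-subcube $C$ gives a copy of $H$ in $S$ if there is a graph isomorphism $f$ from $Q_d$ to $Q_n[C]$ with $f(H)=S\cap C$. Let $\Lambda(H,S)$ be the number of $d$-subcubes giving a copy of $H$ in $S$, let $\Lambda(H,n)=\max\{\Lambda(H,S): S\subseteq\{0,1\}^n\}$ for $n\ge d$, and let the inducibility constant be $\lambda(H)=\lim_{n\to\infty}\Lambda(H,n)/\big(\binom nd 2^{n-d}\big)$ (the limit exists since the ratio is non-increasing in $n$).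 *)

theory Defs
  imports Complex_Main
begin

text \<open>Vertices of the n-hypercube: 0/1 sequences of length n, encoded as bool lists
  (False = 0, True = 1).\<close>
definition cube :: "nat \<Rightarrow> bool list set" where
  "cube n = {xs. length xs = n}"

definition adj :: "bool list \<Rightarrow> bool list \<Rightarrow> bool" where
  "adj x y \<longleftrightarrow> length x = length y \<and> card {i. i < length x \<and> x ! i \<noteq> y ! i} = 1"

definition subcube :: "nat \<Rightarrow> nat \<Rightarrow> bool list set \<Rightarrow> bool" where
  "subcube n d C \<longleftrightarrow> (\<exists>D a. D \<subseteq> {..<n} \<and> card D = d \<and> a \<in> cube n \<and>
      C = {x \<in> cube n. \<forall>i<n. i \<notin> D \<longrightarrow> x ! i = a ! i})"

definition gives_copy :: "nat \<Rightarrow> bool list set \<Rightarrow> bool list set \<Rightarrow> bool list set \<Rightarrow> bool" where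
  "gives_copy d H S C \<longleftrightarrow> (\<exists>f. bij_betw f (cube d) C \<and>
      (\<forall>x\<in>cube d. \<forall>y\<in>cube d. adj x y \<longleftrightarrow> adj (f x) (f y)) \<and>
      f ` H = S \<inter> C)"

definition Lambda_set :: "nat \<Rightarrow> bool list set \<Rightarrow> nat \<Rightarrow> bool list set \<Rightarrow> nat" where
  "Lambda_set d H n S = card {C. subcube n d C \<and> gives_copy d H S C}"

definition Lambda_max :: "nat \<Rightarrow> bool list set \<Rightarrow> nat \<Rightarrow> nat" where
  "Lambda_max d H n = Max {Lambda_set d H n S | S. S \<subseteq> cube n}"

text \<open>The normalised ratio \<Lambda>(H,n) / (binom(n,d) 2^(n-d)); the inducibility constant
  \<lambda>(H) is its limit as n \<rightarrow> \<infinity>.\<close>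
definition ind_ratio :: "nat \<Rightarrow> bool list set \<Rightarrow> nat \<Rightarrow> real" where
  "ind_ratio d H n = real (Lambda_max d H n) / (real (n choose d) * 2 ^ (n - d))"

definition W7 :: "bool list set" where
  "W7 = {[False,False,False], [True,True,True]}"
definition W8 :: "bool list set" where
  "W8 = {[False,False,True], [False,True,False], [True,False,False]}"
definition W9 :: "bool list set" where
  "W9 = {[False,False,False], [False,False,True], [False,True,False], [True,True,True]}"
definition W10 :: "bool list set" where
  "W10 = {[False,False,False], [False,False,True], [True,True,True]}"
definition W12 :: "bool list set" where
  "W12 = {[False,False,False], [False,False,True], [False,True,False], [True,False,False]}"

end

theory Submission
  imports Defs "HOL-Combinatorics.Multiset_Permutations"
begin

text \<open>
  Upper bounds. Summed over all directions k of the cube, the square of a sum of g(k) turns into a sum of g(k) g(l) over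
  pairs of directions, where g(k) depends on the pattern of S on a face containing the direction k; so it is a sum over
  frames of a function of the restricted pattern. After averaging over the automorphisms of the cube, the bound for
  the density of H becomes a pointwise inequality for the subsets of a 3-cube (for W8: of a 4-cube). One square suffices
  for W7 and W12, while W9 and W10 need five and six. For W8 the square compares, for each 2-face with two antipodal
  points of S, the extensions to a star around either of its other two corners. Allowing equal directions makes all
  these identities exact, and only costs a factor tending to 1.

  Lower bounds. Let commuting permutations of a finite set of states, one for each letter, act on a random state
  through a random word with one letter for each coordinate of v, and let v belong to S if the resulting state is
  distinguished. Whether a subcube is a copy of H is then decided by the letters of its directions and a uniformly
  distributed state. The colourings are the weight modulo 3 for W7 and W8, modulo 4 for W12, and modulo 4 with a third
  of the coordinates counted twice for W9. For W10 the states are the vertices of the 6-cube modulo its antipodal map.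
\<close>

section \<open>Embeddings of cubes\<close>

definition flip :: "nat \<Rightarrow> bool list \<Rightarrow> bool list" where
  "flip i v = v[i := \<not> v ! i]"

fun act_on :: "('a \<Rightarrow> 's \<Rightarrow> 's) \<Rightarrow> 's \<Rightarrow> 'a list \<Rightarrow> bool list \<Rightarrow> 's" where
  "act_on f s (a # w) (b # x) = (if b then f a (act_on f s w x) else act_on f s w x)"
| "act_on f s _ _ = s"

abbreviation embed :: "bool list \<Rightarrow> nat list \<Rightarrow> bool list \<Rightarrow> bool list" where
  "embed \<equiv> act_on flip"

abbreviation origin :: "nat \<Rightarrow> bool list" where
  "origin n \<equiv> replicate n False"

definition directions :: "nat \<Rightarrow> nat \<Rightarrow> nat list set" where
  "directions n d = {ds. length ds = d \<and> distinct ds \<and> set ds \<subseteq> {..<n}}"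

definition face :: "nat \<Rightarrow> nat set \<Rightarrow> bool list \<Rightarrow> bool list set" where
  "face n D v = {w \<in> cube n. \<forall>i<n. i \<notin> D \<longrightarrow> w ! i = v ! i}"

definition pattern :: "bool list set \<Rightarrow> bool list \<Rightarrow> nat list \<Rightarrow> bool list set" where
  "pattern S v ds = {x \<in> cube (length ds). embed v ds x \<in> S}"

lemma length_flip [simp]: "length (flip i v) = length v"
  by (simp add: flip_def)

lemma nth_flip: "flip i v ! m = (if m = i \<and> m < length v then \<not> v ! m else v ! m)"
  by (cases "m = i") (simp_all add: flip_def list_update_beyond)

lemma flip_flip [simp]: "flip i (flip i v) = v"
  by (rule nth_equalityI) (auto simp: nth_flip)

lemma flip_commute: "flip i (flip j v) = flip j (flip i v)"
  by (rule nth_equalityI) (auto simp: nth_flip)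

lemma flip_Cons [simp]: "flip 0 (b # x) = (\<not> b) # x" "flip (Suc i) (b # x) = b # flip i x"
  by (simp_all add: flip_def)

lemma flip_neq: "i < length v \<Longrightarrow> flip i v \<noteq> v"
  using nth_flip[of i v i] by auto

lemma inj_on_flip: "inj_on (\<lambda>i. flip i v) {..<length v}"
proof (rule inj_onI)
  fix i j assume i: "i \<in> {..<length v}" and eq: "flip i v = flip j v"
  have "flip i v ! i = flip j v ! i" unfolding eq ..
  then show "i = j" using i by (auto simp: nth_flip split: if_splits)
qed

lemma length_embed [simp]: "length (embed v ds x) = length v"
  by (induction ds x rule: list_induct2') simp_all

lemma embed_in_cube [simp]: "embed v ds x \<in> cube n \<longleftrightarrow> v \<in> cube n"
  by (simp add: cube_def)

lemma act_on_origin [simp]: "act_on f s w (origin m) = s"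
proof (induction w arbitrary: m)
  case (Cons a w)
  then show ?case by (cases m) simp_all
qed simp

lemma embed_flip_root: "embed (flip i v) ds x = flip i (embed v ds x)"
  by (induction ds x rule: list_induct2') (simp_all add: flip_commute)

lemma embed_involution [simp]: "embed (embed v ds a) ds a = v"
  by (induction ds a rule: list_induct2') (simp_all add: embed_flip_root)

lemma embed_flip:
  assumes "j < length ds" "length x = length ds"
  shows "embed v ds (flip j x) = flip (ds ! j) (embed v ds x)"
  using assms
proof (induction ds x arbitrary: j rule: list_induct2')
  case (4 i ds b x)
  then show ?case by (cases j) (auto simp: flip_commute)
qed simp_all

lemma embed_embed:
  assumes "set \<rho> \<subseteq> {..<length ds}" "length a = length ds"
  shows "embed v ds (embed a \<rho> x) = embed (embed v ds a) (map ((!) ds) \<rho>) x"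
  using assms by (induction \<rho> x rule: list_induct2') (simp_all add: embed_flip)

lemma nth_embed_notin: "m \<notin> set ds \<Longrightarrow> embed v ds x ! m = v ! m"
  by (induction ds x rule: list_induct2') (auto simp: nth_flip)

lemma nth_embed:
  assumes "distinct ds" "set ds \<subseteq> {..<length v}" "j < length ds" "length x = length ds"
  shows "embed v ds x ! (ds ! j) = (v ! (ds ! j) \<noteq> x ! j)"
  using assms
proof (induction ds x arbitrary: j rule: list_induct2')
  case (4 i ds b x)
  show ?case
  proof (cases j)
    case 0
    then show ?thesis using 4 by (simp add: nth_flip nth_embed_notin)
  next
    case (Suc k)
    then have "ds ! k \<noteq> i" using 4 by auto
    then show ?thesis using 4 Suc by (simp add: nth_flip)
  qed
qed simp_all

lemma image_embed:
  assumes v: "v \<in> cube n" and ds: "ds \<in> directions n d"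
  shows "embed v ds ` cube d = face n (set ds) v"
proof (intro equalityI subsetI)
  fix w assume "w \<in> embed v ds ` cube d"
  then show "w \<in> face n (set ds) v" using v by (auto simp: face_def nth_embed_notin)
next
  fix w assume w: "w \<in> face n (set ds) v"
  define x where "x = map (\<lambda>i. v ! i \<noteq> w ! i) ds"
  have "w = embed v ds x"
  proof (rule nth_equalityI)
    fix m assume m: "m < length w"
    show "w ! m = embed v ds x ! m"
    proof (cases "m \<in> set ds")
      case True
      then obtain j where "j < length ds" "m = ds ! j" by (auto simp: in_set_conv_nth)
      then show ?thesis using v ds by (auto simp: nth_embed x_def directions_def cube_def)
    next
      case False
      then show ?thesis using w m by (simp add: face_def nth_embed_notin cube_def)
    qed
  qed (use v w in \<open>simp add: cube_def face_def\<close>)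
  moreover have "x \<in> cube d" using ds by (simp add: x_def cube_def directions_def)
  ultimately show "w \<in> embed v ds ` cube d" by blast
qed

lemma inj_on_embed:
  assumes "v \<in> cube n" "ds \<in> directions n d"
  shows "inj_on (embed v ds) (cube d)"
proof (rule inj_onI)
  fix x y assume xy: "x \<in> cube d" "y \<in> cube d" "embed v ds x = embed v ds y"
  show "x = y"
  proof (rule nth_equalityI)
    fix j assume "j < length x"
    then show "x ! j = y ! j"
      using xy assms nth_embed[of ds v j x] nth_embed[of ds v j y] by (auto simp: cube_def directions_def)
  qed (use xy in \<open>simp add: cube_def\<close>)
qed

lemma flip_in_cube [simp]: "flip i v \<in> cube n \<longleftrightarrow> v \<in> cube n"
  by (simp add: cube_def)

lemma origin_in_cube [simp]: "origin d \<in> cube d"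
  by (simp add: cube_def)

lemma finite_cube [simp]: "finite (cube n)"
  using finite_lists_length_eq[of "UNIV :: bool set" n] by (simp add: cube_def)

lemma card_cube: "card (cube n) = 2 ^ n"
  using card_lists_length_eq[of "UNIV :: bool set" n] by (simp add: cube_def)

lemma sum_cube_0: "(\<Sum>v\<in>cube 0. f v) = f []"
proof -
  have "cube 0 = {[]}" by (auto simp: cube_def)
  then show ?thesis by simp
qed

lemma sum_cube_Suc: "(\<Sum>v\<in>cube (Suc n). f v) = (\<Sum>b\<in>UNIV. \<Sum>v\<in>cube n. f (b # v))"
  unfolding sum.cartesian_product
  by (rule sum.reindex_bij_witness[of _ "\<lambda>(b, v). b # v" "\<lambda>v. (hd v, tl v)"])
    (auto simp: cube_def length_Suc_conv)

lemma finite_directions [simp]: "finite (directions n d)"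
  by (rule finite_subset[OF _ finite_lists_length_eq[of "{..<n}" d]]) (auto simp: directions_def)

lemma directions_set_eq: "ds \<in> directions d d \<Longrightarrow> set ds = {..<d}"
  by (intro card_subset_eq) (auto simp: directions_def distinct_card)

lemma directions_eq_permutations: "directions d d = permutations_of_set {..<d}"
proof (intro set_eqI iffI)
  fix ds
  assume "ds \<in> directions d d"
  then show "ds \<in> permutations_of_set {..<d}"
    using directions_set_eq[of ds d] by (simp add: permutations_of_set_def) (simp add: directions_def)
next
  fix ds
  assume "ds \<in> permutations_of_set {..<d}"
  then show "ds \<in> directions d d"
    using distinct_card[of ds] by (simp add: permutations_of_set_def directions_def)
qed

lemma inj_on_nth_directions: "ds \<in> directions n d \<Longrightarrow> inj_on ((!) ds) {..<d}"
  by (auto simp: directions_def inj_on_def nth_eq_iff_index_eq)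

lemma map_nth_directions:
  "ds \<in> directions n d \<Longrightarrow> \<rho> \<in> directions d r \<Longrightarrow> map ((!) ds) \<rho> \<in> directions n r"
  by (auto simp: directions_def distinct_map subset_iff inj_on_def nth_eq_iff_index_eq)

lemma inj_on_map_nth_directions:
  assumes "ds \<in> directions n d"
  shows "inj_on (map ((!) ds)) (directions d r)"
  using inj_on_nth_directions[OF assms]
  by (intro inj_on_mapI) (auto simp: directions_def intro!: inj_on_subset[of "(!) ds" "{..<d}"])

lemma directions_reorder:
  assumes "ds \<in> directions n d" "es \<in> directions n d" "set es \<subseteq> set ds"
  obtains \<rho> where "\<rho> \<in> directions d d" "es = map ((!) ds) \<rho>"
proof -
  have "\<exists>j<d. ds ! j = i" if "i \<in> set es" for i
    using assms that in_set_conv_nth[of i ds] by (auto simp: directions_def subset_iff)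
  then obtain pos where pos: "\<And>i. i \<in> set es \<Longrightarrow> pos i < d \<and> ds ! pos i = i" by metis
  define \<rho> where "\<rho> = map pos es"
  have es: "es = map ((!) ds) \<rho>" unfolding \<rho>_def map_map by (rule map_idI[symmetric]) (simp add: pos)
  moreover have "length es = d" "distinct es" using assms by (simp_all add: directions_def)
  moreover have "inj_on pos (set es)" by (rule inj_onI) (metis pos)
  ultimately have "\<rho> \<in> directions d d"
    using pos by (auto simp: directions_def \<rho>_def distinct_map)
  then show thesis using that es by blast
qed

lemma directions_mapping_onto:
  assumes "I \<subseteq> {..<d}" "J \<subseteq> {..<d}" "card I = card J"
  obtains \<rho> where "\<rho> \<in> directions d d" "(!) \<rho> ` J = I"
proof -
  have fin: "finite I" "finite J" using assms finite_subset by blast+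
  obtain f where f: "bij_betw f J I" using finite_same_card_bij[OF fin(2,1)] assms(3) by auto
  have "card ({..<d} - J) = card ({..<d} - I)" using assms fin by (simp add: card_Diff_subset)
  then obtain g where g: "bij_betw g ({..<d} - J) ({..<d} - I)" using finite_same_card_bij[of "{..<d} - J"] by blast
  define \<pi> where "\<pi> i = (if i \<in> J then f i else g i)" for i
  have J: "\<pi> ` J = I" using f by (simp add: \<pi>_def bij_betw_def)
  moreover have "bij_betw \<pi> (J \<union> ({..<d} - J)) (I \<union> ({..<d} - I))"
    using bij_betw_disjoint_Un[OF f g] by (simp add: \<pi>_def[abs_def])
  then have "bij_betw \<pi> {..<d} {..<d}" using assms(1,2) by (simp add: Un_absorb1)
  then have "map \<pi> [0..<d] \<in> directions d d"
    by (auto simp: directions_def distinct_map bij_betw_def atLeast0LessThan)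
  moreover have "(!) (map \<pi> [0..<d]) ` J = \<pi> ` J" using assms(2) by (intro image_cong) auto
  ultimately show thesis using that by metis
qed

lemma embed_ones:
  assumes "x \<in> cube d" "\<rho> \<in> directions d d"
  shows "embed x \<rho> (replicate d True) = map Not x"
proof (rule nth_equalityI)
  fix m assume "m < length (embed x \<rho> (replicate d True))"
  then have "m \<in> set \<rho>" using assms by (simp add: directions_set_eq cube_def)
  then obtain j where "j < length \<rho>" "m = \<rho> ! j" by (auto simp: in_set_conv_nth)
  then show "embed x \<rho> (replicate d True) ! m = map Not x ! m"
    using assms by (auto simp: nth_embed directions_def cube_def subset_iff)
qed simp

lemma pattern_subset_cube: "pattern S v ds \<subseteq> cube (length ds)"
  by (auto simp: pattern_def)

lemma pattern_pattern:
  assumes "set \<rho> \<subseteq> {..<length ds}" "a \<in> cube (length ds)"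
  shows "pattern (pattern S v ds) a \<rho> = pattern S (embed v ds a) (map ((!) ds) \<rho>)"
  using assms by (auto simp: pattern_def embed_embed cube_def)

lemma pattern_pattern_origin:
  assumes "set \<rho> \<subseteq> {..<length ds}" "length ds = m"
  shows "pattern (pattern S v ds) (origin m) \<rho> = pattern S v (map ((!) ds) \<rho>)"
  using assms by (subst pattern_pattern) auto

lemma pattern_identity:
  assumes "P \<subseteq> cube d"
  shows "pattern P (origin d) [0..<d] = P"
proof -
  have "embed (origin d) [0..<d] x = x" if "x \<in> cube d" for x
  proof (rule nth_equalityI)
    fix j assume "j < length (embed (origin d) [0..<d] x)"
    then show "embed (origin d) [0..<d] x ! j = x ! j"
      using that nth_embed[of "[0..<d]" "origin d" j x] by (auto simp: cube_def lessThan_atLeast0)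
  qed (use that in \<open>simp add: cube_def\<close>)
  then show ?thesis using assms by (auto simp: pattern_def)
qed

section \<open>Copies as embedded patterns\<close>

lemma adj_iff_flip: "adj x y \<longleftrightarrow> (\<exists>i<length x. y = flip i x)"
proof
  assume "adj x y"
  then have len: "length x = length y" and "card {i. i < length x \<and> x ! i \<noteq> y ! i} = 1"
    by (auto simp: adj_def)
  then obtain i where i: "{i. i < length x \<and> x ! i \<noteq> y ! i} = {i}"
    by (auto simp: card_1_singleton_iff)
  then have "y = flip i x"
    using len by (intro nth_equalityI) (auto simp: nth_flip set_eq_iff)
  then show "\<exists>i<length x. y = flip i x" using i by blast
next
  assume "\<exists>i<length x. y = flip i x"
  then obtain i where i: "i < length x" "y = flip i x" by blast
  then have "{m. m < length x \<and> x ! m \<noteq> y ! m} = {i}" by (auto simp: nth_flip)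
  then show "adj x y" using i by (simp add: adj_def)
qed

lemma adj_sym: "adj x y \<Longrightarrow> adj y x"
  by (auto simp: adj_iff_flip)

lemma adj_flip: "x \<in> cube n \<Longrightarrow> i < n \<Longrightarrow> adj x (flip i x)"
  by (auto simp: adj_iff_flip cube_def)

lemma second_common_neighbour:
  assumes "i \<noteq> j" "i < length p" "j < length p"
    and "adj q (flip i p)" "adj q (flip j p)" "q \<noteq> p"
  shows "q = flip i (flip j p)"
proof -
  obtain m where m: "m < length p" "q = flip m (flip i p)"
    using adj_sym[OF assms(4)] by (auto simp: adj_iff_flip)
  obtain l where l: "l < length p" "q = flip l (flip j p)"
    using adj_sym[OF assms(5)] by (auto simp: adj_iff_flip)
  have "flip m (flip i p) ! i = flip l (flip j p) ! i" using m l by simp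
  moreover have "m \<noteq> i" using m assms(6) by auto
  ultimately have "l = i" using m l assms(1-3) by (auto simp: nth_flip split: if_splits)
  then show ?thesis using l by simp
qed

lemma common_neighbours_unique:
  assumes "a \<noteq> b" "adj p a" "adj p b"
    and "adj q a" "adj q b" "q \<noteq> p" "adj r a" "adj r b" "r \<noteq> p"
  shows "q = r"
proof -
  obtain i j where "i < length p" "a = flip i p" "j < length p" "b = flip j p"
    using assms(2,3) by (auto simp: adj_iff_flip)
  then show ?thesis using assms second_common_neighbour[of i j p] by metis
qed

lemma cube_support_induct [consumes 1, case_names origin flip]:
  assumes "x \<in> cube d"
    and origin: "P (origin d)"
    and flip: "\<And>x i. x \<in> cube d \<Longrightarrow> i < d \<Longrightarrow> x ! i \<Longrightarrow> (\<And>j. j < d \<Longrightarrow> x ! j \<Longrightarrow> P (flip j x)) \<Longrightarrow>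
      (\<And>j. j < d \<Longrightarrow> j \<noteq> i \<Longrightarrow> x ! j \<Longrightarrow> P (flip j (flip i x))) \<Longrightarrow> P x"
  shows "P x"
  using assms(1)
proof (induction "card {i. i < d \<and> x ! i}" arbitrary: x rule: less_induct)
  case less
  have smaller: "card {m. m < d \<and> flip j y ! m} < card {m. m < d \<and> y ! m}"
    if "y \<in> cube d" "j < d" "y ! j" for y j
    using that by (intro psubset_card_mono) (auto simp: nth_flip cube_def)
  show ?case
  proof (cases "\<exists>i<d. x ! i")
    case True
    then obtain i where i: "i < d" "x ! i" by blast
    show ?thesis
    proof (rule flip[OF less.prems i])
      fix j assume j: "j < d" "x ! j"
      then show "P (flip j x)" using less smaller by simp
      assume "j \<noteq> i"
      then have "card {m. m < d \<and> flip j (flip i x) ! m} < card {m. m < d \<and> flip i x ! m}"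
        using less.prems j by (intro smaller) (auto simp: nth_flip)
      also have "\<dots> < card {m. m < d \<and> x ! m}" by (intro smaller less.prems i)
      finally show "P (flip j (flip i x))" using less by simp
    qed
  next
    case False
    then have "x = origin d"
      using less.prems by (intro nth_equalityI) (auto simp: cube_def)
    then show ?thesis using origin by simp
  qed
qed

lemma adj_embed:
  assumes v: "v \<in> cube n" and ds: "ds \<in> directions n d" and xy: "x \<in> cube d" "y \<in> cube d"
  shows "adj (embed v ds x) (embed v ds y) \<longleftrightarrow> adj x y"
proof
  have len: "length ds = d" "length x = d" "length v = n" using assms by (simp_all add: directions_def cube_def)
  show "adj (embed v ds x) (embed v ds y)" if "adj x y"
  proof -
    obtain i where i: "i < d" "y = flip i x" using \<open>adj x y\<close> len by (auto simp: adj_iff_flip)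
    then have "ds ! i < n" using ds len by (auto simp: directions_def subset_iff)
    moreover have "embed v ds y = flip (ds ! i) (embed v ds x)" using i len by (simp add: embed_flip)
    ultimately show ?thesis using len by (auto simp: adj_iff_flip)
  qed
  assume "adj (embed v ds x) (embed v ds y)"
  then obtain m where m: "m < n" "embed v ds y = flip m (embed v ds x)" using len by (auto simp: adj_iff_flip)
  then have "embed v ds y ! m \<noteq> embed v ds x ! m" using len by (simp add: nth_flip)
  then have "m \<in> set ds" using nth_embed_notin by metis
  then obtain i where i: "i < d" "m = ds ! i" using len by (auto simp: in_set_conv_nth)
  then have "embed v ds y = embed v ds (flip i x)" using m len by (simp add: embed_flip)
  then have "y = flip i x" using inj_on_embed[OF v ds] xy by (simp add: inj_on_def)
  then show "adj x y" using i len by (auto simp: adj_iff_flip)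
qed

definition adj_embedding :: "nat \<Rightarrow> (bool list \<Rightarrow> bool list) \<Rightarrow> bool" where
  "adj_embedding d f \<longleftrightarrow> inj_on f (cube d) \<and> (\<forall>x\<in>cube d. \<forall>y\<in>cube d. adj x y \<longrightarrow> adj (f x) (f y))"

lemma adj_embedding_eq_iff:
  "adj_embedding d f \<Longrightarrow> x \<in> cube d \<Longrightarrow> y \<in> cube d \<Longrightarrow> f x = f y \<longleftrightarrow> x = y"
  by (auto simp: adj_embedding_def inj_on_def)

lemma adj_embedding_adj:
  "adj_embedding d f \<Longrightarrow> x \<in> cube d \<Longrightarrow> y \<in> cube d \<Longrightarrow> adj x y \<Longrightarrow> adj (f x) (f y)"
  by (simp add: adj_embedding_def)

text \<open>Two neighbours of a vertex have a unique second common neighbour, so vertices of larger weight are forced.\<close>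

lemma adj_embedding_unique:
  assumes f: "adj_embedding d f" and g: "adj_embedding d g"
    and origin: "f (origin d) = g (origin d)"
    and unit: "\<And>i. i < d \<Longrightarrow> f (flip i (origin d)) = g (flip i (origin d))"
    and x: "x \<in> cube d"
  shows "f x = g x"
  using x
proof (induction x rule: cube_support_induct)
  case origin
  show ?case by (fact assms(3))
next
  case (flip x i)
  show ?case
  proof (cases "\<exists>j<d. j \<noteq> i \<and> x ! j")
    case True
    then obtain j where j: "j < d" "j \<noteq> i" "x ! j" by blast
    define u where "u = flip j (flip i x)"
    have u: "u \<in> cube d" using flip(1) by (simp add: u_def)
    have neq: "x \<noteq> u" "flip i x \<noteq> flip j x"
      using flip(1,2) j inj_onD[OF inj_on_flip[of x], of i j] flip_flip[of j x]
      by (auto simp: u_def cube_def) (metis flip_flip flip_commute)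
    have adj: "adj u (flip i x)" "adj u (flip j x)" "adj x (flip i x)" "adj x (flip j x)"
      using adj_flip flip(1,2) j u by (metis flip_commute flip_flip u_def)+
    have eq: "f (flip i x) = g (flip i x)" "f (flip j x) = g (flip j x)" "f u = g u"
      using flip.IH flip.hyps j by (simp_all add: u_def)
    show ?thesis
    proof (rule common_neighbours_unique[of "f (flip i x)" "f (flip j x)" "f u"])
      show "adj (g x) (f (flip i x))" "adj (g x) (f (flip j x))" "g x \<noteq> f u"
        unfolding eq using g adj neq u flip(1) by (simp_all add: adj_embedding_eq_iff adj_embedding_adj)
    qed (use f adj neq u flip(1) in \<open>simp_all add: adj_embedding_eq_iff adj_embedding_adj\<close>)
  next
    case False
    then have "flip i x = origin d"
      using flip(1,2,3) by (intro nth_equalityI) (auto simp: nth_flip cube_def)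
    then have "x = flip i (origin d)" by (metis flip_flip)
    then show ?thesis using unit flip(2) by simp
  qed
qed

lemma adj_embedding_embed: "v \<in> cube n \<Longrightarrow> ds \<in> directions n d \<Longrightarrow> adj_embedding d (embed v ds)"
  by (simp add: adj_embedding_def inj_on_embed adj_embed)

lemma adj_embedding_eq_embed:
  assumes f: "adj_embedding d f" and into: "f ` cube d \<subseteq> cube n"
  obtains w es where "w \<in> cube n" "es \<in> directions n d" "\<And>x. x \<in> cube d \<Longrightarrow> f x = embed w es x"
proof -
  define w where "w = f (origin d)"
  have w: "w \<in> cube n" using into by (auto simp: w_def)
  have "\<exists>m<n. f (flip i (origin d)) = flip m w" if "i < d" for i
    using adj_embedding_adj[OF f _ _ adj_flip[OF _ that]] w by (auto simp: w_def adj_iff_flip cube_def)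
  then obtain dir where dir: "\<And>i. i < d \<Longrightarrow> dir i < n \<and> f (flip i (origin d)) = flip (dir i) w"
    by metis
  define es where "es = map dir [0..<d]"
  have "inj_on dir {..<d}"
  proof (rule inj_onI)
    fix i j assume ij: "i \<in> {..<d}" "j \<in> {..<d}" "dir i = dir j"
    then have "f (flip i (origin d)) = f (flip j (origin d))" using dir by auto
    then have "flip i (origin d) = flip j (origin d)" using f by (simp add: adj_embedding_eq_iff)
    then show "i = j" using ij inj_onD[OF inj_on_flip[of "origin d"]] by simp
  qed
  then have es: "es \<in> directions n d"
    using dir by (auto simp: directions_def es_def distinct_map atLeast0LessThan)
  have "f x = embed w es x" if "x \<in> cube d" for x
  proof (rule adj_embedding_unique[OF f adj_embedding_embed[OF w es] _ _ that])
    show "f (flip i (origin d)) = embed w es (flip i (origin d))" if "i < d" for i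
      using dir[OF that] that by (simp add: embed_flip es_def)
  qed (simp add: w_def)
  then show thesis using that w es by blast
qed

lemma gives_copy_iff_embed:
  assumes H: "H \<subseteq> cube d" and C: "C \<subseteq> cube n"
  shows "gives_copy d H S C \<longleftrightarrow>
    (\<exists>w\<in>cube n. \<exists>es\<in>directions n d. embed w es ` cube d = C \<and> pattern S w es = H)"
proof
  assume "gives_copy d H S C"
  then obtain f where bij: "bij_betw f (cube d) C"
      and adj: "\<And>x y. x \<in> cube d \<Longrightarrow> y \<in> cube d \<Longrightarrow> adj x y \<Longrightarrow> adj (f x) (f y)"
      and img: "f ` H = S \<inter> C"
    unfolding gives_copy_def by blast
  then have inj: "inj_on f (cube d)" and range: "f ` cube d = C" by (auto simp: bij_betw_def)
  have "adj_embedding d f" using inj adj by (simp add: adj_embedding_def)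
  then obtain w es where w: "w \<in> cube n" and es: "es \<in> directions n d"
      and f: "\<And>x. x \<in> cube d \<Longrightarrow> f x = embed w es x"
    using adj_embedding_eq_embed[of d f n] range C by blast
  have "embed w es ` cube d = C" using f range by (metis image_cong)
  moreover have "pattern S w es = H"
  proof -
    have "x \<in> H \<longleftrightarrow> f x \<in> S \<inter> C" if "x \<in> cube d" for x
      unfolding img[symmetric] using inj_on_image_mem_iff[OF inj that H] by simp
    then show ?thesis using H es f range by (auto simp: pattern_def directions_def)
  qed
  ultimately show "\<exists>w\<in>cube n. \<exists>es\<in>directions n d. embed w es ` cube d = C \<and> pattern S w es = H"
    using w es by blast
next
  assume "\<exists>w\<in>cube n. \<exists>es\<in>directions n d. embed w es ` cube d = C \<and> pattern S w es = H"
  then obtain w es where w: "w \<in> cube n" "es \<in> directions n d" "embed w es ` cube d = C" "pattern S w es = H"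
    by blast
  have "bij_betw (embed w es) (cube d) C" using inj_on_embed[OF w(1,2)] w(3) by (simp add: bij_betw_def)
  moreover have "embed w es ` H = S \<inter> C"
    using w(2) unfolding w(3,4)[symmetric] by (auto simp: pattern_def directions_def)
  ultimately show "gives_copy d H S C"
    unfolding gives_copy_def using adj_embed[OF w(1,2)] by blast
qed

lemma embed_automorphism:
  assumes "a \<in> cube d" "\<rho> \<in> directions d d"
  shows "embed a \<rho> ` cube d = cube d"
  using image_embed[OF assms] directions_set_eq[OF assms(2)] by (auto simp: face_def)

lemma image_embed_eq_iff:
  assumes v: "v \<in> cube n" and ds: "ds \<in> directions n d" and w: "w \<in> cube n" and es: "es \<in> directions n d"
  shows "embed w es ` cube d = embed v ds ` cube d \<longleftrightarrow>
    (\<exists>a\<in>cube d. \<exists>\<rho>\<in>directions d d. w = embed v ds a \<and> es = map ((!) ds) \<rho>)"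
proof
  assume eq: "embed w es ` cube d = embed v ds ` cube d"
  have "embed w es (origin d) \<in> embed w es ` cube d" by (intro imageI) simp
  then obtain a where a: "a \<in> cube d" "w = embed v ds a" unfolding eq by auto
  have faces: "face n (set es) w = face n (set ds) v" using eq image_embed assms by metis
  have "set es \<subseteq> set ds"
  proof (rule ccontr)
    assume "\<not> set es \<subseteq> set ds"
    then obtain i where i: "i \<in> set es" "i \<notin> set ds" by blast
    have "i < n" using i(1) es by (auto simp: directions_def)
    moreover have "w \<in> face n (set es) w" "flip i w \<in> face n (set es) w"
      using w i(1) by (auto simp: face_def nth_flip)
    ultimately have "w ! i = v ! i" "flip i w ! i = v ! i" using i(2) unfolding faces by (auto simp: face_def)
    then show False using \<open>i < n\<close> w by (simp add: nth_flip cube_def)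
  qed
  then show "\<exists>a\<in>cube d. \<exists>\<rho>\<in>directions d d. w = embed v ds a \<and> es = map ((!) ds) \<rho>"
    using directions_reorder[OF ds es] a by metis
next
  assume "\<exists>a\<in>cube d. \<exists>\<rho>\<in>directions d d. w = embed v ds a \<and> es = map ((!) ds) \<rho>"
  then obtain a \<rho> where a: "a \<in> cube d" "\<rho> \<in> directions d d" "w = embed v ds a" "es = map ((!) ds) \<rho>" by blast
  then have "embed w es x = embed v ds (embed a \<rho> x)" for x
    using ds by (subst embed_embed) (auto simp: directions_def cube_def)
  then have "embed w es ` cube d = embed v ds ` embed a \<rho> ` cube d" by (simp add: image_image)
  then show "embed w es ` cube d = embed v ds ` cube d" by (simp add: embed_automorphism a)
qed

definition copies :: "nat \<Rightarrow> bool list set \<Rightarrow> bool list set set" where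
  "copies d H = {P. P \<subseteq> cube d \<and> (\<exists>a\<in>cube d. \<exists>\<rho>\<in>directions d d. pattern P a \<rho> = H)}"

lemma copies_of_pattern:
  assumes P: "P \<subseteq> cube d" and a: "a \<in> cube d" "\<rho> \<in> directions d d" and copy: "pattern P a \<rho> \<in> copies d H"
  shows "P \<in> copies d H"
proof -
  obtain b \<sigma> where b: "b \<in> cube d" "\<sigma> \<in> directions d d" "pattern (pattern P a \<rho>) b \<sigma> = H"
    using copy by (auto simp: copies_def)
  then have "pattern P (embed a \<rho> b) (map ((!) \<rho>) \<sigma>) = H"
    using a by (subst (asm) pattern_pattern) (auto simp: directions_def)
  moreover have "embed a \<rho> b \<in> cube d" using a by simp
  ultimately show ?thesis using P map_nth_directions[OF a(2) b(2)] unfolding copies_def by blast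
qed

lemma image_embed_in_copies:
  assumes H: "H \<subseteq> cube d" and a: "a \<in> cube d" and \<rho>: "\<rho> \<in> directions d d"
  shows "embed a \<rho> ` H \<in> copies d H"
proof -
  have "pattern (embed a \<rho> ` H) a \<rho> = H"
    using H \<rho> inj_on_image_mem_iff[OF inj_on_embed[OF a \<rho>]] by (auto simp: pattern_def directions_def)
  then show ?thesis using H a \<rho> by (auto simp: copies_def)
qed

lemma gives_copy_iff_pattern:
  assumes H: "H \<subseteq> cube d" and v: "v \<in> cube n" and ds: "ds \<in> directions n d"
  shows "gives_copy d H S (embed v ds ` cube d) \<longleftrightarrow> pattern S v ds \<in> copies d H"
proof -
  have "gives_copy d H S (embed v ds ` cube d) \<longleftrightarrow>
      (\<exists>w\<in>cube n. \<exists>es\<in>directions n d. embed w es ` cube d = embed v ds ` cube d \<and> pattern S w es = H)"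
    using v by (intro gives_copy_iff_embed[OF H]) auto
  also have "\<dots> \<longleftrightarrow> (\<exists>a\<in>cube d. \<exists>\<rho>\<in>directions d d. pattern S (embed v ds a) (map ((!) ds) \<rho>) = H)"
    using image_embed_eq_iff[OF v ds] v map_nth_directions[OF ds] by (metis embed_in_cube)
  also have "\<dots> \<longleftrightarrow> (\<exists>a\<in>cube d. \<exists>\<rho>\<in>directions d d. pattern (pattern S v ds) a \<rho> = H)"
    using ds by (intro bex_cong refl) (subst pattern_pattern; auto simp: directions_def)
  also have "\<dots> \<longleftrightarrow> pattern S v ds \<in> copies d H"
    using pattern_subset_cube[of S v ds] ds by (auto simp: copies_def directions_def)
  finally show ?thesis .
qed

lemma subcube_iff_embed:
  "subcube n d C \<longleftrightarrow> (\<exists>v\<in>cube n. \<exists>ds\<in>directions n d. C = embed v ds ` cube d)"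
proof
  assume "subcube n d C"
  then obtain D v where D: "D \<subseteq> {..<n}" "card D = d" "v \<in> cube n" "C = face n D v"
    unfolding subcube_def face_def by blast
  have "finite D" using D(1) finite_subset by blast
  then obtain ds where "set ds = D" "distinct ds" using finite_distinct_list by blast
  then have "ds \<in> directions n d" "C = embed v ds ` cube d"
    using D distinct_card[of ds] image_embed[of v n ds d] by (auto simp: directions_def)
  then show "\<exists>v\<in>cube n. \<exists>ds\<in>directions n d. C = embed v ds ` cube d" using D(3) by blast
next
  assume "\<exists>v\<in>cube n. \<exists>ds\<in>directions n d. C = embed v ds ` cube d"
  then obtain v ds where "v \<in> cube n" "ds \<in> directions n d" "C = face n (set ds) v" using image_embed by metis
  then show "subcube n d C"
    unfolding subcube_def face_def by (intro exI[of _ "set ds"] exI[of _ v]) (auto simp: directions_def distinct_card)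
qed

lemma card_directions:
  assumes "d \<le> n"
  shows "card (directions n d) = fact d * (n choose d)"
proof -
  have "card (directions n d) = \<Prod>{n - d + 1..n}"
    using card_lists_distinct_length_eq[of "{..<n}" d] assms by (simp add: directions_def)
  also have "\<dots> = fact n div fact (n - d)" by (simp add: fact_div_fact)
  also have "\<dots> = fact d * (n choose d)"
    by (simp flip: binomial_fact_lemma[OF assms])
  finally show ?thesis .
qed

lemma card_frames_of_subcube:
  assumes v: "v \<in> cube n" and ds: "ds \<in> directions n d"
  shows "card {(w, es) \<in> cube n \<times> directions n d. embed w es ` cube d = embed v ds ` cube d} = 2 ^ d * fact d"
proof -
  define reframe where "reframe = (\<lambda>(a, \<rho>). (embed v ds a, map ((!) ds) \<rho>))"
  have "inj_on reframe (cube d \<times> directions d d)"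
    using inj_on_embed[OF v ds] inj_on_map_nth_directions[OF ds, of d]
    by (auto simp: reframe_def inj_on_def)
  moreover have "w \<in> cube n \<and> es \<in> directions n d \<and> embed w es ` cube d = embed v ds ` cube d \<longleftrightarrow>
      (\<exists>a\<in>cube d. \<exists>\<rho>\<in>directions d d. w = embed v ds a \<and> es = map ((!) ds) \<rho>)" for w es
    using image_embed_eq_iff[OF v ds, of w es] v map_nth_directions[OF ds] by (metis embed_in_cube)
  then have "{(w, es) \<in> cube n \<times> directions n d. embed w es ` cube d = embed v ds ` cube d} =
      reframe ` (cube d \<times> directions d d)"
    by (auto simp: reframe_def image_iff)
  ultimately show ?thesis by (simp add: card_image card_cartesian_product card_cube card_directions)
qed

lemma card_frames:
  "card {(v, ds) \<in> cube n \<times> directions n d. Q (embed v ds ` cube d)} =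
    2 ^ d * fact d * card {C. subcube n d C \<and> Q C}"
proof -
  define A where "A = {(v, ds) \<in> cube n \<times> directions n d. Q (embed v ds ` cube d)}"
  define B where "B = {C. subcube n d C \<and> Q C}"
  define span where "span = (\<lambda>(v, ds). embed v ds ` cube d)"
  have "finite A" by (rule finite_subset[of _ "cube n \<times> directions n d"]) (auto simp: A_def)
  moreover have "finite B" by (rule finite_subset[of _ "Pow (cube n)"]) (auto simp: B_def subcube_def)
  moreover have "span ` A \<subseteq> B" by (auto simp: A_def B_def span_def subcube_iff_embed)
  ultimately have "card A = (\<Sum>C\<in>B. card {x \<in> A. span x = C})"
    using sum.group[of A B span "\<lambda>_. 1 :: nat"] by simp
  also have "\<dots> = (\<Sum>C\<in>B. 2 ^ d * fact d)"
  proof (rule sum.cong[OF refl])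
    fix C assume "C \<in> B"
    then obtain v ds where v: "v \<in> cube n" "ds \<in> directions n d" and C: "C = embed v ds ` cube d" "Q C"
      by (auto simp: B_def subcube_iff_embed)
    have "{x \<in> A. span x = C} = {(w, es) \<in> cube n \<times> directions n d. embed w es ` cube d = embed v ds ` cube d}"
      using C by (auto simp: A_def span_def)
    then show "card {x \<in> A. span x = C} = 2 ^ d * fact d" by (simp only: card_frames_of_subcube[OF v])
  qed
  finally show ?thesis by (simp add: A_def B_def)
qed

lemma card_subcubes:
  assumes "d \<le> n"
  shows "card {C. subcube n d C} = (n choose d) * 2 ^ (n - d)"
proof -
  have "2 ^ d * fact d * card {C. subcube n d C} = card (cube n \<times> directions n d)"
    using card_frames[of n d "\<lambda>_. True"] by simp
  also have "\<dots> = 2 ^ d * fact d * ((n choose d) * 2 ^ (n - d))"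
    using assms by (simp add: card_cartesian_product card_cube card_directions flip: power_add)
  finally show ?thesis by simp
qed

lemma card_copy_frames:
  assumes "H \<subseteq> cube d"
  shows "card {(v, ds) \<in> cube n \<times> directions n d. pattern S v ds \<in> copies d H} =
    2 ^ d * fact d * Lambda_set d H n S"
  unfolding Lambda_set_def card_frames[symmetric]
  by (rule arg_cong[of _ _ card]) (auto simp: gives_copy_iff_pattern[OF assms])

section \<open>Sums of patterns over all frames\<close>

definition words :: "'a set \<Rightarrow> nat \<Rightarrow> 'a list set" where
  "words A m = {xs. set xs \<subseteq> A \<and> length xs = m}"

lemma finite_words [simp]: "finite A \<Longrightarrow> finite (words A m)"
  by (simp add: words_def finite_lists_length_eq)

lemma card_words: "finite A \<Longrightarrow> card (words A m) = card A ^ m"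
  by (simp add: words_def card_lists_length_eq)

lemma directions_subset_words: "directions n d \<subseteq> words {..<n} d"
  by (auto simp: directions_def words_def)

lemma sum_words_0 [simp]: "(\<Sum>xs\<in>words A 0. f xs) = f []"
proof -
  have "words A 0 = {[]}" by (auto simp: words_def)
  then show ?thesis by simp
qed

lemma sum_words_append:
  "(\<Sum>xs\<in>words A (r + q). f xs) = (\<Sum>ys\<in>words A r. \<Sum>zs\<in>words A q. f (ys @ zs))"
  unfolding sum.cartesian_product
  by (rule sum.reindex_bij_witness[of _ "\<lambda>(ys, zs). ys @ zs" "\<lambda>xs. (take r xs, drop r xs)"])
    (auto simp: words_def dest: in_set_takeD in_set_dropD)

lemma sum_words_Suc:
  "(\<Sum>xs\<in>words A (Suc m). f xs) = (\<Sum>i\<in>A. \<Sum>xs\<in>words A m. f (i # xs))"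
  unfolding sum.cartesian_product
  by (rule sum.reindex_bij_witness[of _ "\<lambda>(i, xs). i # xs" "\<lambda>xs. (hd xs, tl xs)"])
    (auto simp: words_def length_Suc_conv)

lemma bij_betw_map_nth_words:
  assumes "finite A" and \<sigma>: "\<sigma> \<in> directions m m"
  shows "bij_betw (\<lambda>xs. map ((!) xs) \<sigma>) (words A m) (words A m)"
proof -
  have "inj_on (\<lambda>xs. map ((!) xs) \<sigma>) (words A m)"
    by (rule inj_onI) (auto simp: words_def directions_set_eq[OF \<sigma>] intro: nth_equalityI)
  moreover have "(\<lambda>xs. map ((!) xs) \<sigma>) ` words A m \<subseteq> words A m"
    using \<sigma> by (auto simp: words_def directions_def subset_iff)
  ultimately show ?thesis
    using assms(1) by (simp add: bij_betw_def endo_inj_surj)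
qed

lemma sum_words_map_nth:
  fixes f :: "'a list \<Rightarrow> 'b :: comm_semiring_1"
  assumes A: "finite A" and \<rho>: "\<rho> \<in> directions m r"
  shows "(\<Sum>xs\<in>words A m. f (map ((!) xs) \<rho>)) = of_nat (card A) ^ (m - r) * (\<Sum>ys\<in>words A r. f ys)"
proof -
  define \<sigma> where "\<sigma> = \<rho> @ sorted_list_of_set ({..<m} - set \<rho>)"
  have len: "length \<rho> = r" "r \<le> m"
    using \<rho> card_mono[of "{..<m}" "set \<rho>"] by (auto simp: directions_def distinct_card)
  have "card ({..<m} - set \<rho>) = m - r"
    using \<rho> by (subst card_Diff_subset) (auto simp: directions_def distinct_card)
  then have \<sigma>: "\<sigma> \<in> directions m m"
    using \<rho> len by (auto simp: directions_def \<sigma>_def)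
  have "(\<Sum>xs\<in>words A m. f (map ((!) xs) \<rho>)) = (\<Sum>xs\<in>words A m. f (take r (map ((!) xs) \<sigma>)))"
    using len by (simp add: \<sigma>_def)
  also have "\<dots> = (\<Sum>xs\<in>words A (r + (m - r)). f (take r xs))"
    using sum.reindex_bij_betw[OF bij_betw_map_nth_words[OF A \<sigma>], of "\<lambda>xs. f (take r xs)"] len by simp
  also have "\<dots> = (\<Sum>ys\<in>words A r. \<Sum>zs\<in>words A (m - r). f ys)"
    unfolding sum_words_append by (intro sum.cong refl) (auto simp: words_def)
  also have "\<dots> = of_nat (card A) ^ (m - r) * (\<Sum>ys\<in>words A r. f ys)"
    using A by (simp add: card_words sum_distrib_left)
  finally show ?thesis .
qed

lemma sum_cube_embed: "(\<Sum>v\<in>cube n. f (embed v ds a)) = (\<Sum>v\<in>cube n. f v)"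
  by (rule sum.reindex_bij_witness[of _ "\<lambda>v. embed v ds a" "\<lambda>v. embed v ds a"]) auto

definition pattern_sum :: "nat \<Rightarrow> nat \<Rightarrow> bool list set \<Rightarrow> (bool list set \<Rightarrow> real) \<Rightarrow> real" where
  "pattern_sum m n S h = (\<Sum>v\<in>cube n. \<Sum>ds\<in>words {..<n} m. h (pattern S v ds))"

lemma pattern_sum_add: "pattern_sum m n S (\<lambda>P. g P + h P) = pattern_sum m n S g + pattern_sum m n S h"
  by (simp add: pattern_sum_def sum.distrib)

lemma pattern_sum_cmult: "pattern_sum m n S (\<lambda>P. c * h P) = c * pattern_sum m n S h"
  by (simp add: pattern_sum_def sum_distrib_left)

lemma pattern_sum_sum: "pattern_sum m n S (\<lambda>P. \<Sum>i\<in>I. h i P) = (\<Sum>i\<in>I. pattern_sum m n S (h i))"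
  by (simp add: pattern_sum_def sum.swap[of _ "words {..<n} m" I] sum.swap[of _ "cube n" I])

lemma pattern_sum_cong:
  "(\<And>P. P \<subseteq> cube m \<Longrightarrow> g P = h P) \<Longrightarrow> pattern_sum m n S g = pattern_sum m n S h"
  using pattern_subset_cube unfolding pattern_sum_def by (intro sum.cong refl) (auto simp: words_def)

lemma pattern_sum_le_const:
  assumes "\<And>P. P \<subseteq> cube m \<Longrightarrow> h P \<le> c"
  shows "pattern_sum m n S h \<le> c * (2 ^ n * real n ^ m)"
proof -
  have "pattern_sum m n S h \<le> (\<Sum>v\<in>cube n. \<Sum>ds\<in>words {..<n} m. c)"
    unfolding pattern_sum_def
    using assms pattern_subset_cube by (intro sum_mono) (auto simp: words_def)
  then show ?thesis by (simp add: card_cube card_words mult_ac)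
qed

lemma pattern_sum_subpattern:
  assumes a: "a \<in> cube m" and \<rho>: "\<rho> \<in> directions m r"
  shows "pattern_sum m n S (\<lambda>P. h (pattern P a \<rho>)) = real n ^ (m - r) * pattern_sum r n S h"
proof -
  have "pattern_sum m n S (\<lambda>P. h (pattern P a \<rho>)) =
      (\<Sum>v\<in>cube n. \<Sum>ds\<in>words {..<n} m. h (pattern S (embed v ds a) (map ((!) ds) \<rho>)))"
    unfolding pattern_sum_def using a \<rho>
    by (intro sum.cong refl arg_cong[of _ _ h] pattern_pattern) (auto simp: words_def directions_def)
  also have "\<dots> = (\<Sum>ds\<in>words {..<n} m. \<Sum>v\<in>cube n. h (pattern S v (map ((!) ds) \<rho>)))"
    by (subst sum.swap) (simp add: sum_cube_embed[where f = "\<lambda>v. h (pattern S v _)"])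
  also have "\<dots> = real n ^ (m - r) * (\<Sum>ds\<in>words {..<n} r. \<Sum>v\<in>cube n. h (pattern S v ds))"
    using sum_words_map_nth[OF _ \<rho>, of "{..<n}" "\<lambda>ds. \<Sum>v\<in>cube n. h (pattern S v ds)"] by simp
  finally show ?thesis by (simp add: pattern_sum_def sum.swap[of _ "cube n"])
qed

definition symmetrize :: "nat \<Rightarrow> (bool list set \<Rightarrow> real) \<Rightarrow> bool list set \<Rightarrow> real" where
  "symmetrize m h P = (\<Sum>a\<in>cube m. \<Sum>\<rho>\<in>directions m m. h (pattern P a \<rho>))"

lemma pattern_sum_symmetrize: "pattern_sum m n S (symmetrize m h) = 2 ^ m * fact m * pattern_sum m n S h"
  by (simp add: symmetrize_def[abs_def] pattern_sum_sum pattern_sum_subpattern card_cube card_directions)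

lemma symmetrize_pattern:
  assumes b: "b \<in> cube m" and \<sigma>: "\<sigma> \<in> directions m m"
  shows "symmetrize m h (pattern P b \<sigma>) = symmetrize m h P"
proof -
  have len: "length \<sigma> = m" using \<sigma> by (simp add: directions_def)
  have "bij_betw (embed b \<sigma>) (cube m) (cube m)"
    using inj_on_embed[OF b \<sigma>] embed_automorphism[OF b \<sigma>] by (simp add: bij_betw_def)
  moreover have "map ((!) \<sigma>) ` directions m m \<subseteq> directions m m" using map_nth_directions[OF \<sigma>] by blast
  then have "bij_betw (map ((!) \<sigma>)) (directions m m) (directions m m)"
    using inj_on_map_nth_directions[OF \<sigma>] by (simp add: bij_betw_def endo_inj_surj)
  moreover have "symmetrize m h (pattern P b \<sigma>) =
      (\<Sum>a\<in>cube m. \<Sum>\<rho>\<in>directions m m. h (pattern P (embed b \<sigma> a) (map ((!) \<sigma>) \<rho>)))"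
    unfolding symmetrize_def
    by (intro sum.cong refl arg_cong[of _ _ h] pattern_pattern) (auto simp: len directions_def)
  ultimately show ?thesis
    unfolding symmetrize_def
    by (simp add: sum.reindex_bij_betw[where h = "map ((!) \<sigma>)" and g = "\<lambda>\<rho>. h (pattern P _ \<rho>)"]
        sum.reindex_bij_betw[where h = "embed b \<sigma>" and g = "\<lambda>a. \<Sum>\<rho>\<in>directions m m. h (pattern P a \<rho>)"])
qed

definition square :: "nat \<Rightarrow> (bool list set \<Rightarrow> real) \<Rightarrow> bool list set \<Rightarrow> real" where
  "square m g P = g (pattern P (origin (m + 2)) [0..<m + 1]) *
     g (pattern P (origin (m + 2)) ([0..<m] @ [m + 1]))"

lemma pattern_sum_square_nonneg: "0 \<le> pattern_sum (m + 2) n S (square m g)"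
proof -
  have "square m g (pattern S v (ds @ [k, l])) = g (pattern S v (ds @ [k])) * g (pattern S v (ds @ [l]))"
    if "ds \<in> words {..<n} m" for v ds k l
  proof -
    have len: "length ds = m" using that by (simp add: words_def)
    then have "map ((!) (ds @ [k, l])) [0..<m + 1] = ds @ [k]" "map ((!) (ds @ [k, l])) ([0..<m] @ [m + 1]) = ds @ [l]"
      by (auto intro!: nth_equalityI simp: nth_append)
    then show ?thesis unfolding square_def using len by (subst (1 2) pattern_pattern_origin) auto
  qed
  moreover have "(\<Sum>zs\<in>words {..<n} 2. f zs) = (\<Sum>k<n. \<Sum>l<n. f [k, l])" for f :: "nat list \<Rightarrow> real"
    by (simp add: numeral_2_eq_2 sum_words_Suc)
  ultimately have "pattern_sum (m + 2) n S (square m g) =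
      (\<Sum>v\<in>cube n. \<Sum>ds\<in>words {..<n} m. (\<Sum>k<n. g (pattern S v (ds @ [k]))) * (\<Sum>l<n. g (pattern S v (ds @ [l]))))"
    unfolding pattern_sum_def sum_words_append by (simp add: sum_product)
  also have "\<dots> \<ge> 0" by (intro sum_nonneg) simp
  finally show ?thesis .
qed

definition automorphism_count :: "nat \<Rightarrow> bool list set \<Rightarrow> real" where
  "automorphism_count d H = symmetrize d (\<lambda>P. of_bool (P = H)) H"

lemma automorphism_count_pos:
  assumes "H \<subseteq> cube d"
  shows "0 < automorphism_count d H"
proof -
  have "pattern H (origin d) [0..<d] = H" by (rule pattern_identity[OF assms])
  moreover have "[0..<d] \<in> directions d d" by (auto simp: directions_def)
  ultimately show ?thesis
    unfolding automorphism_count_def symmetrize_def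
    by (intro sum_pos2[of _ "origin d"] sum_pos2[of _ "[0..<d]"]) (auto intro: sum_nonneg)
qed

lemma symmetrize_of_bool_eq:
  assumes "P \<subseteq> cube d"
  shows "symmetrize d (\<lambda>P. of_bool (P = H)) P = automorphism_count d H * of_bool (P \<in> copies d H)"
proof (cases "P \<in> copies d H")
  case True
  then obtain a \<rho> where "a \<in> cube d" "\<rho> \<in> directions d d" "pattern P a \<rho> = H" by (auto simp: copies_def)
  then show ?thesis
    using True symmetrize_pattern[of a d \<rho> "\<lambda>P. of_bool (P = H)" P] by (simp add: automorphism_count_def)
next
  case False
  then have "pattern P a \<rho> \<noteq> H" if "a \<in> cube d" "\<rho> \<in> directions d d" for a \<rho>
    using assms that by (auto simp: copies_def)
  then show ?thesis using False by (simp add: symmetrize_def)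
qed

lemma Lambda_set_le_pattern_sum:
  assumes H: "H \<subseteq> cube d"
  shows "automorphism_count d H * real (Lambda_set d H n S) \<le> pattern_sum d n S (\<lambda>P. of_bool (P = H))"
proof -
  define ind where "ind P = (of_bool (P \<in> copies d H) :: real)" for P
  have "2 ^ d * fact d * real (Lambda_set d H n S) =
      real (card {(v, ds) \<in> cube n \<times> directions n d. pattern S v ds \<in> copies d H})"
    by (simp only: card_copy_frames[OF H]) simp
  also have "\<dots> = (\<Sum>(v, ds)\<in>cube n \<times> directions n d. ind (pattern S v ds))"
    by (simp add: ind_def of_bool_def sum.If_cases Int_def case_prod_unfold mem_Times_iff)
  also have "\<dots> \<le> (\<Sum>(v, ds)\<in>cube n \<times> words {..<n} d. ind (pattern S v ds))"
    using directions_subset_words by (intro sum_mono2) (auto simp: ind_def)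
  also have "\<dots> = pattern_sum d n S ind" by (simp only: pattern_sum_def sum.cartesian_product)
  finally have "automorphism_count d H * (2 ^ d * fact d * real (Lambda_set d H n S))
      \<le> automorphism_count d H * pattern_sum d n S ind"
    using automorphism_count_pos[OF H] by simp
  also have "\<dots> = pattern_sum d n S (symmetrize d (\<lambda>P. of_bool (P = H)))"
    unfolding pattern_sum_cmult[symmetric] ind_def
    by (rule pattern_sum_cong) (simp add: symmetrize_of_bool_eq)
  finally show ?thesis by (simp add: pattern_sum_symmetrize mult_ac)
qed

lemma pattern_sum_le_symmetrized:
  assumes "d \<le> m" "0 < n" and nonneg: "0 \<le> pattern_sum m n S h"
    and bound: "\<And>P. P \<subseteq> cube m \<Longrightarrow>
      symmetrize m (\<lambda>P. g (pattern P (origin m) [0..<d]) + h P) P \<le> M * (2 ^ m * fact m)"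
  shows "pattern_sum d n S g \<le> M * (2 ^ n * real n ^ d)"
proof -
  have initial: "[0..<d] \<in> directions m d" using \<open>d \<le> m\<close> by (auto simp: directions_def)
  let ?F = "\<lambda>P. g (pattern P (origin m) [0..<d]) + h P"
  have "pattern_sum m n S (symmetrize m ?F) \<le> M * (2 ^ m * fact m) * (2 ^ n * real n ^ m)"
    using bound by (rule pattern_sum_le_const)
  then have "2 ^ m * fact m * pattern_sum m n S ?F \<le> 2 ^ m * fact m * (M * (2 ^ n * real n ^ m))"
    by (simp add: pattern_sum_symmetrize mult_ac)
  then have "pattern_sum m n S ?F \<le> M * (2 ^ n * real n ^ m)"
    by (rule mult_left_le_imp_le) simp
  moreover have "pattern_sum m n S ?F = real n ^ (m - d) * pattern_sum d n S g + pattern_sum m n S h"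
    using pattern_sum_subpattern[OF _ initial, of "origin m" n S g] by (simp add: pattern_sum_add)
  ultimately have "real n ^ (m - d) * pattern_sum d n S g \<le> real n ^ (m - d) * (M * (2 ^ n * real n ^ d))"
    using nonneg power_add[of "real n" "m - d" d] \<open>d \<le> m\<close> by (simp add: mult_ac)
  then show ?thesis using \<open>0 < n\<close> by simp
qed

text \<open>The factor n^d counts frames with repeated directions too; it agrees with their true number only asymptotically.\<close>

definition copy_density_le :: "nat \<Rightarrow> bool list set \<Rightarrow> real \<Rightarrow> bool" where
  "copy_density_le d H L \<longleftrightarrow>
    (\<forall>n S. 0 < n \<longrightarrow> 2 ^ d * fact d * real (Lambda_set d H n S) \<le> L * (2 ^ n * real n ^ d))"

lemma copy_density_le_certificate:
  assumes H: "H \<subseteq> cube d" and "d \<le> m" and c: "0 < c"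
    and nonneg: "\<And>n S. 0 \<le> pattern_sum m n S h"
    and bound: "\<And>P. P \<subseteq> cube m \<Longrightarrow>
      symmetrize m (\<lambda>P. c * of_bool (pattern P (origin m) [0..<d] = H) + h P) P \<le> M * (2 ^ m * fact m)"
  shows "copy_density_le d H (M * (2 ^ d * fact d) / (c * automorphism_count d H))"
  unfolding copy_density_le_def
proof (intro allI impI)
  fix n S assume "0 < (n :: nat)"
  let ?N = "real (Lambda_set d H n S)"
  have pos: "0 < c * automorphism_count d H" using c automorphism_count_pos[OF H] by simp
  have "c * automorphism_count d H * ?N \<le> c * pattern_sum d n S (\<lambda>P. of_bool (P = H))"
    using Lambda_set_le_pattern_sum[OF H, of n S] c by simp
  also have "\<dots> = pattern_sum d n S (\<lambda>P. c * of_bool (P = H))" by (rule pattern_sum_cmult[symmetric])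
  also have "\<dots> \<le> M * (2 ^ n * real n ^ d)"
    by (rule pattern_sum_le_symmetrized[OF \<open>d \<le> m\<close> \<open>0 < n\<close> nonneg bound])
  finally have "?N \<le> M * (2 ^ n * real n ^ d) / (c * automorphism_count d H)"
    by (subst pos_le_divide_eq[OF pos]) (simp add: mult_ac)
  then have "2 ^ d * fact d * ?N \<le> 2 ^ d * fact d * (M * (2 ^ n * real n ^ d) / (c * automorphism_count d H))"
    by (intro mult_left_mono) simp_all
  then show "2 ^ d * fact d * ?N \<le> M * (2 ^ d * fact d) / (c * automorphism_count d H) * (2 ^ n * real n ^ d)"
    by (simp add: mult_ac)
qed

lemma copy_density_le_symmetrized:
  assumes H: "H \<subseteq> cube d" and nonneg: "\<And>n S. 0 \<le> pattern_sum d n S h"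
    and bound: "\<And>P. P \<subseteq> cube d \<Longrightarrow> symmetrize d h P \<le> M"
    and extremal: "symmetrize d h H \<le> M - N" and N: "0 < N"
  shows "copy_density_le d H (M / N)"
proof -
  define c where "c = N / automorphism_count d H"
  have c: "0 < c" "c * automorphism_count d H = N"
    using N automorphism_count_pos[OF H] by (simp_all add: c_def)
  have "symmetrize d (\<lambda>P. c * of_bool (pattern P (origin d) [0..<d] = H) + h P) P
      \<le> M / (2 ^ d * fact d) * (2 ^ d * fact d)" if P: "P \<subseteq> cube d" for P
  proof -
    have "pattern (pattern P a \<rho>) (origin d) [0..<d] = pattern P a \<rho>"
      if "\<rho> \<in> directions d d" for a \<rho>
      using that pattern_subset_cube[of P a \<rho>] by (intro pattern_identity) (simp add: directions_def)
    then have "symmetrize d (\<lambda>P. c * of_bool (pattern P (origin d) [0..<d] = H) + h P) P =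
        c * symmetrize d (\<lambda>P. of_bool (P = H)) P + symmetrize d h P"
      by (simp add: symmetrize_def sum.distrib sum_distrib_left mult.commute[of c])
    also have "\<dots> = N * of_bool (P \<in> copies d H) + symmetrize d h P"
      using c(2) by (simp add: symmetrize_of_bool_eq[OF P] flip: mult.assoc)
    also have "\<dots> \<le> M"
    proof (cases "P \<in> copies d H")
      case True
      then obtain a \<rho> where "a \<in> cube d" "\<rho> \<in> directions d d" "pattern P a \<rho> = H" by (auto simp: copies_def)
      then show ?thesis using True extremal symmetrize_pattern[of a d \<rho> h P] by simp
    qed (use bound[OF P] in simp)
    finally show ?thesis by simp
  qed
  from copy_density_le_certificate[OF H order_refl c(1) nonneg this] show ?thesis by (simp add: c(2))
qed

section \<open>Bounds on the inducibility ratio\<close>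

lemma finite_Lambda_sets: "finite {Lambda_set d H n S | S. S \<subseteq> cube n}"
proof -
  have "{Lambda_set d H n S | S. S \<subseteq> cube n} = Lambda_set d H n ` Pow (cube n)" by auto
  then show ?thesis by simp
qed

lemma Lambda_set_le_max: "S \<subseteq> cube n \<Longrightarrow> Lambda_set d H n S \<le> Lambda_max d H n"
  unfolding Lambda_max_def by (rule Max_ge[OF finite_Lambda_sets]) auto

lemma Lambda_max_attained: obtains S where "Lambda_max d H n = Lambda_set d H n S"
proof -
  have "Lambda_max d H n \<in> {Lambda_set d H n S | S. S \<subseteq> cube n}"
    unfolding Lambda_max_def by (rule Max_in[OF finite_Lambda_sets]) auto
  then show thesis using that by auto
qed

lemma ind_ratio_le:
  assumes density: "copy_density_le d H L" and "d \<le> n" "0 < n"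
  shows "ind_ratio d H n \<le> L * (real n ^ d / (fact d * real (n choose d)))"
proof -
  obtain S where S: "Lambda_max d H n = Lambda_set d H n S" by (rule Lambda_max_attained)
  have "(2 :: real) ^ n = 2 ^ d * 2 ^ (n - d)" using \<open>d \<le> n\<close> by (simp flip: power_add)
  moreover have "2 ^ d * fact d * real (Lambda_set d H n S) \<le> L * (2 ^ n * real n ^ d)"
    using density \<open>0 < n\<close> by (simp add: copy_density_le_def)
  ultimately have "fact d * real (Lambda_max d H n) \<le> L * real n ^ d * 2 ^ (n - d)"
    by (simp add: S mult_ac)
  moreover have "0 < real (n choose d)" using \<open>d \<le> n\<close> by (simp add: zero_less_binomial)
  ultimately show ?thesis by (simp add: ind_ratio_def field_simps)
qed

lemma binomial_ratio_tendsto: "(\<lambda>n. real n ^ d / (fact d * real (n choose d))) \<longlonglongrightarrow> 1"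
proof -
  have factor: "(\<lambda>n. (real n - real i) / real n) \<longlonglongrightarrow> 1" for i
  proof (rule Lim_transform_eventually)
    show "(\<lambda>n. 1 - real i / real n) \<longlonglongrightarrow> 1"
      using tendsto_diff[OF tendsto_const lim_const_over_n[of "real i"], of 1] by simp
    show "eventually (\<lambda>n. 1 - real i / real n = (real n - real i) / real n) sequentially"
      using eventually_gt_at_top[of 0] by eventually_elim (simp add: field_simps)
  qed
  have "(\<lambda>n. \<Prod>i = 0..<d. (real n - real i) / real n) \<longlonglongrightarrow> (\<Prod>i = 0..<d. 1)"
    by (intro tendsto_prod factor)
  moreover have "(\<Prod>i = 0..<d. (real n - real i) / real n) = fact d * real (n choose d) / real n ^ d" for n
    by (simp add: prod_dividef binomial_gbinomial gbinomial_prod_rev)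
  ultimately have "(\<lambda>n. fact d * real (n choose d) / real n ^ d) \<longlonglongrightarrow> 1" by simp
  from tendsto_inverse[OF this] show ?thesis by (simp add: inverse_eq_divide)
qed

lemma ind_ratio_tendsto:
  assumes upper: "copy_density_le d H L" and lower: "\<And>n. d \<le> n \<Longrightarrow> L \<le> ind_ratio d H n"
  shows "ind_ratio d H \<longlonglongrightarrow> L"
proof (rule tendsto_sandwich)
  show "eventually (\<lambda>n. L \<le> ind_ratio d H n) sequentially"
    using lower by (rule eventually_sequentiallyI)
  show "eventually (\<lambda>n. ind_ratio d H n \<le> L * (real n ^ d / (fact d * real (n choose d)))) sequentially"
    using eventually_ge_at_top[of d] eventually_gt_at_top[of 0]
    by eventually_elim (rule ind_ratio_le[OF upper])
  show "(\<lambda>n. L * (real n ^ d / (fact d * real (n choose d)))) \<longlonglongrightarrow> L"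
    using tendsto_mult_left[OF binomial_ratio_tendsto, of L d] by simp
qed simp

lemma ind_ratio_ge_average:
  assumes "d \<le> n" "finite \<Omega>" "\<Omega> \<noteq> {}"
    and S: "\<And>\<omega>. \<omega> \<in> \<Omega> \<Longrightarrow> S \<omega> \<subseteq> cube n"
    and copy: "\<And>C. subcube n d C \<Longrightarrow> L * real (card \<Omega>) \<le> real (card {\<omega> \<in> \<Omega>. gives_copy d H (S \<omega>) C})"
  shows "L \<le> ind_ratio d H n"
proof -
  define \<C> where "\<C> = {C. subcube n d C}"
  have finite_\<C>: "finite \<C>"
    by (rule finite_subset[of _ "Pow (cube n)"]) (auto simp: \<C>_def subcube_def)
  have "L * real (card \<Omega>) * real (card \<C>) = (\<Sum>C\<in>\<C>. L * real (card \<Omega>))" by simp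
  also have "\<dots> \<le> (\<Sum>C\<in>\<C>. real (card {\<omega> \<in> \<Omega>. gives_copy d H (S \<omega>) C}))"
    by (intro sum_mono copy) (simp add: \<C>_def)
  also have "\<dots> = real (\<Sum>C\<in>\<C>. \<Sum>\<omega>\<in>\<Omega>. of_bool (gives_copy d H (S \<omega>) C))"
    using \<open>finite \<Omega>\<close> by (simp add: of_bool_def sum.If_cases Int_def)
  also have "\<dots> = real (\<Sum>\<omega>\<in>\<Omega>. \<Sum>C\<in>\<C>. of_bool (gives_copy d H (S \<omega>) C))" by (subst sum.swap) (rule refl)
  also have "\<dots> = (\<Sum>\<omega>\<in>\<Omega>. real (Lambda_set d H n (S \<omega>)))"
    using finite_\<C> by (simp add: of_bool_def sum.If_cases Int_def Lambda_set_def \<C>_def)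
  also have "\<dots> \<le> (\<Sum>\<omega>\<in>\<Omega>. real (Lambda_max d H n))"
    by (intro sum_mono of_nat_mono Lambda_set_le_max S)
  finally have "real (card \<Omega>) * (L * real (card \<C>)) \<le> real (card \<Omega>) * real (Lambda_max d H n)"
    by (simp add: mult_ac)
  then have "L * real (card \<C>) \<le> real (Lambda_max d H n)"
    by (rule mult_left_le_imp_le) (simp add: card_gt_0_iff \<open>finite \<Omega>\<close> \<open>\<Omega> \<noteq> {}\<close>)
  moreover have "real (card \<C>) = real (n choose d) * 2 ^ (n - d)" "0 < n choose d"
    using \<open>d \<le> n\<close> by (simp_all add: \<C>_def card_subcubes zero_less_binomial)
  ultimately show ?thesis by (simp add: ind_ratio_def field_simps)
qed

section \<open>Random colourings\<close>

lemma bij_betw_act_on: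
  assumes "\<And>a. a \<in> set w \<Longrightarrow> bij_betw (f a) T T"
  shows "bij_betw (\<lambda>s. act_on f s w v) T T"
  using assms
proof (induction w v rule: list_induct2')
  case (4 a w b v)
  then have "bij_betw (\<lambda>s. act_on f s w v) T T" "bij_betw (f a) T T" by simp_all
  then show ?case using bij_betw_trans[of "\<lambda>s. act_on f s w v" T T "f a" T] by (cases b) (simp_all add: comp_def)
qed (simp_all add: bij_betw_def)

definition commuting :: "('a \<Rightarrow> 's \<Rightarrow> 's) \<Rightarrow> bool" where
  "commuting f \<longleftrightarrow> (\<forall>a b s. f a (f b s) = f b (f a s))"

lemma act_on_flip:
  assumes comm: "commuting f" and "j < length w" "length v = length w" "\<not> v ! j"
  shows "act_on f s w (flip j v) = f (w ! j) (act_on f s w v)"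
  using assms(2-4)
proof (induction w v arbitrary: j rule: list_induct2')
  case (4 a w b v)
  then show ?case by (cases j) (use comm in \<open>auto simp: commuting_def\<close>)
qed simp_all

lemma act_on_embed:
  assumes "commuting f" and "distinct ds" "set ds \<subseteq> {..<length w}" "length v = length w"
    and "\<And>i. i \<in> set ds \<Longrightarrow> \<not> v ! i"
  shows "act_on f s w (embed v ds x) = act_on f (act_on f s w v) (map ((!) w) ds) x"
  using assms(2-)
proof (induction ds x rule: list_induct2')
  case (4 i ds b x)
  then show ?case by (simp add: act_on_flip[OF assms(1)] nth_embed_notin)
qed simp_all

definition colouring :: "('a \<Rightarrow> 's \<Rightarrow> 's) \<Rightarrow> 's set \<Rightarrow> 'a list \<Rightarrow> 's \<Rightarrow> bool list set" where
  "colouring f F w s = {v \<in> cube (length w). act_on f s w v \<in> F}"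

lemma pattern_colouring:
  assumes "commuting f"
    and "ds \<in> directions (length w) d" "v \<in> cube (length w)" "\<And>i. i \<in> set ds \<Longrightarrow> \<not> v ! i"
  shows "pattern (colouring f F w s) v ds = colouring f F (map ((!) w) ds) (act_on f s w v)"
  using assms by (auto simp: pattern_def colouring_def directions_def act_on_embed cube_def)

lemma subcube_lowest_vertex:
  assumes "subcube n d C"
  obtains v ds where "v \<in> cube n" "ds \<in> directions n d" "C = embed v ds ` cube d" "\<And>i. i \<in> set ds \<Longrightarrow> \<not> v ! i"
proof -
  obtain u ds where u: "u \<in> cube n" "ds \<in> directions n d" "C = embed u ds ` cube d"
    using assms by (auto simp: subcube_iff_embed)
  define v where "v = map (\<lambda>i. i \<notin> set ds \<and> u ! i) [0..<n]"
  have v: "v \<in> cube n" by (simp add: v_def cube_def)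
  moreover have "face n (set ds) u = face n (set ds) v" by (auto simp: face_def v_def)
  then have "C = embed v ds ` cube d" using u v by (simp add: image_embed)
  moreover have "\<not> v ! i" if "i \<in> set ds" for i
    using that u(2) by (auto simp: v_def directions_def subset_iff)
  ultimately show thesis using that u(2) by blast
qed

lemma card_colourings_with_copy:
  assumes H: "H \<subseteq> cube d" and "commuting f" and bij: "\<And>a. a \<in> set w \<Longrightarrow> bij_betw (f a) T T"
    and v: "v \<in> cube (length w)" "\<And>i. i \<in> set ds \<Longrightarrow> \<not> v ! i" and ds: "ds \<in> directions (length w) d"
  shows "card {s \<in> T. gives_copy d H (colouring f F w s) (embed v ds ` cube d)} =
    card {s \<in> T. colouring f F (map ((!) w) ds) s \<in> copies d H}"
proof -
  have "gives_copy d H (colouring f F w s) (embed v ds ` cube d) \<longleftrightarrow>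
      colouring f F (map ((!) w) ds) (act_on f s w v) \<in> copies d H" for s
    using v ds by (simp add: gives_copy_iff_pattern[OF H] pattern_colouring[OF \<open>commuting f\<close>])
  then have "bij_betw (\<lambda>s. act_on f s w v) {s \<in> T. gives_copy d H (colouring f F w s) (embed v ds ` cube d)}
      {s \<in> T. colouring f F (map ((!) w) ds) s \<in> copies d H}"
    using bij_betw_act_on[of w f T v] bij by (auto simp: bij_betw_def inj_on_def image_iff)
  then show ?thesis by (rule bij_betw_same_card)
qed

lemma ind_ratio_ge_colouring:
  fixes f :: "'a \<Rightarrow> 's \<Rightarrow> 's"
  assumes H: "H \<subseteq> cube d" and "d \<le> n" and A: "finite A" "A \<noteq> {}" and T: "finite T" "T \<noteq> {}"
    and f: "commuting f" "\<And>a. a \<in> A \<Longrightarrow> bij_betw (f a) T T"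
    and W: "W \<subseteq> words A d"
    and count: "\<And>w. w \<in> W \<Longrightarrow> r \<le> card {s \<in> T. colouring f F w s \<in> copies d H}"
  shows "real (card W * r) / real (card A ^ d * card T) \<le> ind_ratio d H n"
proof (rule ind_ratio_ge_average[OF \<open>d \<le> n\<close>, where \<Omega> = "words A n \<times> T" and S = "\<lambda>(w, s). colouring f F w s"])
  show "finite (words A n \<times> T)" using A T by simp
  have "card (words A n \<times> T) \<noteq> 0" using A T by (simp add: card_cartesian_product card_words)
  then show "words A n \<times> T \<noteq> {}" by auto
  show "(case \<omega> of (w, s) \<Rightarrow> colouring f F w s) \<subseteq> cube n" if "\<omega> \<in> words A n \<times> T" for \<omega>
    using that by (auto simp: colouring_def words_def)
next
  fix C assume "subcube n d C"
  then obtain v ds where v: "v \<in> cube n" "\<And>i. i \<in> set ds \<Longrightarrow> \<not> v ! i" and ds: "ds \<in> directions n d"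
      and C: "C = embed v ds ` cube d"
    using subcube_lowest_vertex by metis
  let ?L = "real (card W * r) / real (card A ^ d * card T)"
  let ?count = "\<lambda>w. card {s \<in> T. colouring f F w s \<in> copies d H}"
  have "card W * r \<le> (\<Sum>w\<in>W. ?count w)" using sum_mono[of W "\<lambda>_. r" ?count] count by simp
  also have "\<dots> \<le> (\<Sum>w\<in>words A d. ?count w)" using A W by (intro sum_mono2) auto
  finally have words_d: "card W * r \<le> (\<Sum>w\<in>words A d. ?count w)" .
  have "real (card (words A n \<times> T)) = real (card A) ^ (n - d) * real (card A ^ d * card T)"
    using A \<open>d \<le> n\<close> by (simp add: card_cartesian_product card_words flip: power_add)
  then have "?L * real (card (words A n \<times> T)) = real (card A) ^ (n - d) * real (card W * r)"
    using A T by (simp add: card_gt_0_iff)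
  also have "\<dots> \<le> real (card A) ^ (n - d) * real (\<Sum>w\<in>words A d. ?count w)"
    by (intro mult_left_mono of_nat_mono words_d) simp
  also have "\<dots> = real (\<Sum>w\<in>words A n. ?count (map ((!) w) ds))"
    by (simp add: sum_words_map_nth[OF A(1) ds, where f = ?count])
  also have "\<dots> = real (\<Sum>w\<in>words A n. card {s \<in> T. gives_copy d H (colouring f F w s) C})"
    unfolding C using f v ds
    by (intro arg_cong[of _ _ real] sum.cong refl card_colourings_with_copy[OF H, symmetric]) (auto simp: words_def)
  also have "\<dots> = real (card (SIGMA w:words A n. {s \<in> T. gives_copy d H (colouring f F w s) C}))"
    using A T by (simp add: card_SigmaI)
  also have "(SIGMA w:words A n. {s \<in> T. gives_copy d H (colouring f F w s) C}) =
      {\<omega> \<in> words A n \<times> T. gives_copy d H (case \<omega> of (w, s) \<Rightarrow> colouring f F w s) C}"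
    by auto
  finally show "?L * real (card (words A n \<times> T)) \<le>
      real (card {\<omega> \<in> words A n \<times> T. gives_copy d H (case \<omega> of (w, s) \<Rightarrow> colouring f F w s) C})" .
qed

section \<open>Upper bounds for W7, W9, W10 and W12\<close>

lemma sum_permutations_of_set:
  assumes "finite A" "A \<noteq> {}"
  shows "(\<Sum>\<rho>\<in>permutations_of_set A. f \<rho>) = (\<Sum>i\<in>A. \<Sum>\<rho>\<in>permutations_of_set (A - {i}). f (i # \<rho>))"
proof -
  have "(\<Sum>\<rho>\<in>permutations_of_set A. f \<rho>) = (\<Sum>i\<in>A. \<Sum>\<rho>\<in>(#) i ` permutations_of_set (A - {i}). f \<rho>)"
    unfolding permutations_of_set_nonempty[OF assms(2)]
    using assms(1) by (intro sum.UNION_disjoint) auto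
  then show ?thesis by (simp add: sum.reindex)
qed

lemma sum_directions_3:
  fixes f :: "nat list \<Rightarrow> real"
  shows "(\<Sum>\<rho>\<in>directions 3 3. f \<rho>) =
    f [0, 1, 2] + f [0, 2, 1] + (f [1, 0, 2] + f [1, 2, 0]) + (f [2, 0, 1] + f [2, 1, 0])"
proof -
  have "{..<3 :: nat} = {0, 1, 2}" by auto
  then show ?thesis by (simp add: directions_eq_permutations sum_permutations_of_set insert_Diff_if)
qed

lemma W_subset_cube: "W7 \<subseteq> cube 3" "W8 \<subseteq> cube 3" "W9 \<subseteq> cube 3" "W10 \<subseteq> cube 3" "W12 \<subseteq> cube 3"
  by (simp_all add: W7_def W8_def W9_def W10_def W12_def cube_def)

type_synonym edge_weights = "bool \<times> bool \<times> real \<times> real \<times> real \<times> real"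

text \<open>
  Weights (s, t, c0, c1, c2, c3) live on the edges whose ends have colours s and t. A direction is scored by the
  colours of the ends of the parallel edge shifted by it: c0, c1, c2, c3 for 00, 10, 01, 11.
\<close>

fun edge_weight :: "edge_weights \<Rightarrow> bool \<Rightarrow> bool \<Rightarrow> bool \<Rightarrow> bool \<Rightarrow> real" where
  "edge_weight (s, t, c0, c1, c2, c3) a b y z =
    (if a = s \<and> b = t then if z then if y then c3 else c2 else if y then c1 else c0 else 0)"

definition edge_form :: "edge_weights \<Rightarrow> bool list set \<Rightarrow> real" where
  "edge_form c Q = edge_weight c ([False, False] \<in> Q) ([True, False] \<in> Q) ([False, True] \<in> Q) ([True, True] \<in> Q)"

definition edge_score :: "edge_weights \<Rightarrow> bool list set \<Rightarrow> bool list \<Rightarrow> nat \<Rightarrow> nat \<Rightarrow> real" where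
  "edge_score c P a i k = edge_weight c (a \<in> P) (flip i a \<in> P) (flip k a \<in> P) (flip i (flip k a) \<in> P)"

definition certificate :: "(real \<times> edge_weights) list \<Rightarrow> bool list set \<Rightarrow> real" where
  "certificate cs P = (\<Sum>(w, c)\<leftarrow>cs. w * square 1 (edge_form c) P)"

lemma pattern_sum_certificate_nonneg:
  assumes "\<forall>(w, c) \<in> set cs. 0 \<le> w"
  shows "0 \<le> pattern_sum 3 n S (certificate cs)"
  using assms
proof (induction cs)
  case Nil
  then show ?case by (simp add: certificate_def[abs_def] pattern_sum_def)
next
  case (Cons wc cs)
  obtain w c where wc: "wc = (w, c)" by (cases wc)
  have "pattern_sum 3 n S (certificate (wc # cs)) =
      w * pattern_sum (1 + 2) n S (square 1 (edge_form c)) + pattern_sum 3 n S (certificate cs)"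
    by (simp add: certificate_def[abs_def] wc pattern_sum_add pattern_sum_cmult numeral_3_eq_3)
  then show ?case using Cons pattern_sum_square_nonneg[of 1 n S "edge_form c"] by (simp add: wc)
qed

lemma square_edge_form_pattern:
  "square 1 (edge_form c) (pattern P a [i, k, l]) = edge_score c P a i k * edge_score c P a i l"
proof -
  have "edge_form c (pattern P a [i, k]) = edge_score c P a i k" for k
    by (simp add: edge_form_def edge_score_def pattern_def cube_def)
  then show ?thesis
    unfolding square_def by (subst (1 2) pattern_pattern_origin) (auto simp: upt_rec)
qed

lemma symmetrize_square_edge_form:
  "symmetrize 3 (square 1 (edge_form c)) P = 2 * (\<Sum>a\<in>cube 3. edge_score c P a 0 1 * edge_score c P a 0 2
    + edge_score c P a 1 0 * edge_score c P a 1 2 + edge_score c P a 2 0 * edge_score c P a 2 1)"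
  by (simp only: symmetrize_def sum_directions_3 square_edge_form_pattern sum_distrib_left)
    (simp add: algebra_simps)

lemma symmetrize_certificate:
  "symmetrize 3 (certificate cs) P = (\<Sum>(w, c)\<leftarrow>cs. w * symmetrize 3 (square 1 (edge_form c)) P)"
  by (induction cs) (auto simp: certificate_def symmetrize_def sum.distrib sum_distrib_left)

text \<open>
  The squares are integer roundings of numerical solutions of the semidefinite program dual to the extremal problem;
  on the extremal colouring the scores of every edge cancel in the mean.
\<close>

definition certificate_W7 :: "(real \<times> edge_weights) list" where
  "certificate_W7 = [(1, False, False, 0, 1, -1, 0)]"

definition certificate_W9 :: "(real \<times> edge_weights) list" where
  "certificate_W9 = [(2, False, False, 1, 1, 1, -2),
    (4, True, False, 0, 2, -1, 1), (4, True, False, 1, 0, 0, -1),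
    (5, True, True, 0, 1, -1, 0), (5, True, True, 2, -1, -1, 0)]"

definition certificate_W10 :: "(real \<times> edge_weights) list" where
  "certificate_W10 = [(30, False, False, 0, 1, 0, -2), (40, False, False, 0, 3, -2, -2),
    (2, False, False, 5, 3, -4, -3), (95, True, False, 1, -2, 0, 0),
    (25, True, False, 3, 0, -2, -2), (2, True, True, 1, 0, 0, -5)]"

definition certificate_W12 :: "(real \<times> edge_weights) list" where
  "certificate_W12 = [(1, True, False, 1, 0, 0, -1)]"

lemma sum_cube_3:
  fixes f :: "bool list \<Rightarrow> real"
  shows "(\<Sum>v\<in>cube 3. f v) =
    f [False, False, False] + f [False, False, True] + f [False, True, False] + f [False, True, True] +
    f [True, False, False] + f [True, False, True] + f [True, True, False] + f [True, True, True]"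
  by (simp add: numeral_3_eq_3 sum_cube_Suc sum_cube_0 UNIV_bool)

lemma flip_list3:
  "flip 0 [x, y, z] = [\<not> x, y, z]" "flip 1 [x, y, z] = [x, \<not> y, z]" "flip 2 [x, y, z] = [x, y, \<not> z]"
  by (simp_all add: flip_def numeral_2_eq_2)

lemmas certificate_eval = symmetrize_certificate symmetrize_square_edge_form sum_cube_3 edge_score_def flip_list3
  not_True_eq_False not_False_eq_True certificate_W7_def certificate_W9_def certificate_W10_def certificate_W12_def
  list.map sum_list.Nil sum_list.Cons split_conv edge_weight.simps

lemmas certificate_reduce = simp_thms if_True if_False if_cancel mult_zero_left mult_zero_right add_0_left add_0_right

lemma symmetrize_certificate_le:
  "symmetrize 3 (certificate certificate_W7) P \<le> 12" "symmetrize 3 (certificate certificate_W9) P \<le> 96"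
  "symmetrize 3 (certificate certificate_W10) P \<le> 2400" "symmetrize 3 (certificate certificate_W12) P \<le> 12"
  by (simp only: certificate_eval,
    cases "[False, False, False] \<in> P"; cases "[False, False, True] \<in> P"; cases "[False, True, False] \<in> P";
    cases "[False, True, True] \<in> P"; simp only: certificate_reduce;
    cases "[True, False, False] \<in> P"; cases "[True, False, True] \<in> P"; cases "[True, True, False] \<in> P";
    cases "[True, True, True] \<in> P"; simp)+

lemma symmetrize_certificate_extremal:
  "symmetrize 3 (certificate certificate_W7) W7 \<le> 12 - 36"
  "symmetrize 3 (certificate certificate_W9) W9 \<le> 96 - 216"
  "symmetrize 3 (certificate certificate_W10) W10 \<le> 2400 - 5760"
  "symmetrize 3 (certificate certificate_W12) W12 \<le> 12 - 24"
  by (simp_all add: certificate_eval W7_def W9_def W10_def W12_def del: One_nat_def)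

lemma copy_density_le_W7: "copy_density_le 3 W7 (1 / 3)"
  using copy_density_le_symmetrized[OF W_subset_cube(1) pattern_sum_certificate_nonneg
      symmetrize_certificate_le(1) symmetrize_certificate_extremal(1)]
  by (simp add: certificate_W7_def)

lemma copy_density_le_W9: "copy_density_le 3 W9 (4 / 9)"
  using copy_density_le_symmetrized[OF W_subset_cube(3) pattern_sum_certificate_nonneg
      symmetrize_certificate_le(2) symmetrize_certificate_extremal(2)]
  by (simp add: certificate_W9_def)

lemma copy_density_le_W10: "copy_density_le 3 W10 (5 / 12)"
  using copy_density_le_symmetrized[OF W_subset_cube(4) pattern_sum_certificate_nonneg
      symmetrize_certificate_le(3) symmetrize_certificate_extremal(3)]
  by (simp add: certificate_W10_def)

lemma copy_density_le_W12: "copy_density_le 3 W12 (1 / 2)"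
  using copy_density_le_symmetrized[OF W_subset_cube(5) pattern_sum_certificate_nonneg
      symmetrize_certificate_le(4) symmetrize_certificate_extremal(4)]
  by (simp add: certificate_W12_def)

section \<open>The upper bound for W8\<close>

definition star_at :: "bool list set \<Rightarrow> bool list \<Rightarrow> nat \<Rightarrow> nat \<Rightarrow> nat \<Rightarrow> bool" where
  "star_at P a i j k \<longleftrightarrow> a \<notin> P \<and> flip i a \<in> P \<and> flip j a \<in> P \<and> flip k a \<in> P \<and>
    flip i (flip j a) \<notin> P \<and> flip i (flip k a) \<notin> P \<and> flip j (flip k a) \<notin> P \<and> flip i (flip j (flip k a)) \<notin> P"

lemma mem_pattern_3: "[x, y, z] \<in> pattern P a [i, j, k] \<longleftrightarrow> embed a [i, j, k] [x, y, z] \<in> P"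
  by (simp add: pattern_def cube_def)

lemma pattern_eq_W8_iff: "pattern P a [i, j, k] = W8 \<longleftrightarrow> star_at P a i j k"
proof -
  have "w \<in> pattern P a [i, j, k] \<longleftrightarrow> w \<in> W8" if "\<And>x y z. [x, y, z] \<in> pattern P a [i, j, k] \<longleftrightarrow> [x, y, z] \<in> W8" for w
  proof (cases "length w = 3")
    case True
    then obtain x y z where "w = [x, y, z]" by (auto simp: numeral_3_eq_3 length_Suc_conv)
    then show ?thesis using that by simp
  next
    case False
    then show ?thesis by (auto simp: W8_def pattern_def cube_def)
  qed
  then have "pattern P a [i, j, k] = W8 \<longleftrightarrow> (\<forall>x y z. [x, y, z] \<in> pattern P a [i, j, k] \<longleftrightarrow> [x, y, z] \<in> W8)"
    by blast
  then show ?thesis by (auto simp: mem_pattern_3 all_bool_eq W8_def star_at_def)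
qed

definition star_difference :: "bool list set \<Rightarrow> real" where
  "star_difference Q = of_bool (Q = W8) - of_bool (pattern Q [True, True, False] [0, 1, 2] = W8)"

definition star_balance :: "bool list set \<Rightarrow> bool list \<Rightarrow> nat \<Rightarrow> nat \<Rightarrow> nat \<Rightarrow> real" where
  "star_balance P a i j k = of_bool (star_at P a i j k) - of_bool (star_at P (flip i (flip j a)) i j k)"

lemma star_difference_pattern: "star_difference (pattern P a [i, j, k]) = star_balance P a i j k"
proof -
  have "pattern (pattern P a [i, j, k]) [True, True, False] [0, 1, 2] = pattern P (flip i (flip j a)) [i, j, k]"
    by (subst pattern_pattern) (auto simp: cube_def)
  then show ?thesis by (simp add: star_difference_def star_balance_def pattern_eq_W8_iff)
qed

definition star_functional :: "bool list set \<Rightarrow> real" where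
  "star_functional P = 24 * of_bool (pattern P (origin 4) [0..<3] = W8) + 4 * square 2 star_difference P"

lemma star_functional_pattern:
  "star_functional (pattern P a [i, j, k, l]) =
    24 * of_bool (star_at P a i j k) + 4 * (star_balance P a i j k * star_balance P a i j l)"
proof -
  have "pattern (pattern P a [i, j, k, l]) (origin 4) [0..<3] = pattern P a [i, j, k]"
    by (subst pattern_pattern_origin) (simp_all add: upt_rec)
  moreover have "square 2 star_difference (pattern P a [i, j, k, l]) = star_balance P a i j k * star_balance P a i j l"
    unfolding square_def star_difference_pattern[symmetric] by (subst (1 2) pattern_pattern_origin) (auto simp: upt_rec)
  ultimately show ?thesis by (simp add: star_functional_def pattern_eq_W8_iff)
qed

lemma sum_star_balance_le:
  "(\<Sum>a\<in>cube n. star_balance P a i j k * star_balance P a i j l) \<le>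
    2 * (\<Sum>a\<in>cube n. of_bool (star_at P a i j k \<and> star_at P a i j l))"
proof -
  define both where "both a = (of_bool (star_at P a i j k \<and> star_at P a i j l) :: real)" for a
  have "star_balance P a i j k * star_balance P a i j l \<le> both a + both (flip i (flip j a))" for a
    by (auto simp: star_balance_def both_def)
  then have "(\<Sum>a\<in>cube n. star_balance P a i j k * star_balance P a i j l)
      \<le> (\<Sum>a\<in>cube n. both a + both (flip i (flip j a)))" by (intro sum_mono) simp
  also have "\<dots> = 2 * (\<Sum>a\<in>cube n. both a)"
    using sum_cube_embed[of both "[i, j]" "[True, True]" n] by (simp add: sum.distrib)
  finally show ?thesis by (simp add: both_def)
qed

lemma sum_star_functional_le:
  assumes "card {a \<in> cube n. star_at P a i j k} \<le> 1"
  shows "(\<Sum>a\<in>cube n. star_functional (pattern P a [i, j, k, l])) \<le> 32"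
proof -
  have count: "(\<Sum>a\<in>cube n. of_bool (Q a)) = real (card {a \<in> cube n. Q a})" for Q
    by (simp add: of_bool_def sum.If_cases Int_def)
  have "card {a \<in> cube n. star_at P a i j k \<and> star_at P a i j l} \<le> card {a \<in> cube n. star_at P a i j k}"
    by (intro card_mono) auto
  then show ?thesis
    using assms sum_star_balance_le[where n = n and P = P and i = i and j = j and k = k and l = l]
    unfolding star_functional_pattern sum.distrib sum_distrib_left[symmetric] count by linarith
qed

lemma sum_cube_4:
  fixes f :: "bool list \<Rightarrow> real"
  shows "(\<Sum>v\<in>cube 4. f v) =
    f [False, False, False, False] + f [False, False, False, True] + f [False, False, True, False] +
    f [False, False, True, True] + f [False, True, False, False] + f [False, True, False, True] +
    f [False, True, True, False] + f [False, True, True, True] + f [True, False, False, False] +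
    f [True, False, False, True] + f [True, False, True, False] + f [True, False, True, True] +
    f [True, True, False, False] + f [True, True, False, True] + f [True, True, True, False] +
    f [True, True, True, True]"
  by (simp add: numeral_eq_Suc sum_cube_Suc sum_cube_0 UNIV_bool)

lemma flip_list4:
  "flip 0 [x, y, z, u] = [\<not> x, y, z, u]" "flip 1 [x, y, z, u] = [x, \<not> y, z, u]"
  "flip 2 [x, y, z, u] = [x, y, \<not> z, u]" "flip 3 [x, y, z, u] = [x, y, z, \<not> u]"
  by (simp_all add: flip_def numeral_2_eq_2 numeral_3_eq_3)

lemma sum_directions_4:
  fixes f :: "nat list \<Rightarrow> real"
  shows "(\<Sum>\<rho>\<in>directions 4 4. f \<rho>) =
    f [0, 1, 2, 3] + f [0, 1, 3, 2] + f [0, 2, 1, 3] +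
    f [0, 2, 3, 1] + f [0, 3, 1, 2] + f [0, 3, 2, 1] +
    f [1, 0, 2, 3] + f [1, 0, 3, 2] + f [1, 2, 0, 3] +
    f [1, 2, 3, 0] + f [1, 3, 0, 2] + f [1, 3, 2, 0] +
    f [2, 0, 1, 3] + f [2, 0, 3, 1] + f [2, 1, 0, 3] +
    f [2, 1, 3, 0] + f [2, 3, 0, 1] + f [2, 3, 1, 0] +
    f [3, 0, 1, 2] + f [3, 0, 2, 1] + f [3, 1, 0, 2] +
    f [3, 1, 2, 0] + f [3, 2, 0, 1] + f [3, 2, 1, 0]"
proof -
  have "{..<4 :: nat} = {0, 1, 2, 3}" by auto
  then show ?thesis by (simp add: directions_eq_permutations sum_permutations_of_set insert_Diff_if)
qed

text \<open>Two opposite facets that are stars determine the whole 4-cube.\<close>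

lemma symmetrize_star_functional_opposite:
  assumes Q: "star_at Q [False, False, False, False] 0 1 2" and b: "star_at Q [x, y, z, u] 0 1 2" "x \<or> y \<or> z \<or> u"
  shows "symmetrize 4 star_functional Q \<le> 768"
proof -
  have lower: "[False, False, False, False] \<notin> Q" "[True, False, False, False] \<in> Q" "[False, True, False, False] \<in> Q"
    "[False, False, True, False] \<in> Q" "[True, True, False, False] \<notin> Q" "[True, False, True, False] \<notin> Q"
    "[False, True, True, False] \<notin> Q" "[True, True, True, False] \<notin> Q"
    using Q by (simp_all add: star_at_def flip_list4 del: One_nat_def)
  then have u using b by (cases x; cases y; cases z; cases u; simp add: star_at_def flip_list4 del: One_nat_def)
  then show ?thesis
    using lower b(1)
    unfolding symmetrize_def sum_cube_4 sum_directions_4 star_functional_pattern star_balance_def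
    by (cases x; cases y; cases z; simp add: star_at_def flip_list4 del: One_nat_def)
qed

lemma symmetrize_star_functional_le: "symmetrize 4 star_functional P \<le> 768"
proof (cases "\<exists>i j k l. [i, j, k, l] \<in> directions 4 4 \<and> \<not> card {a \<in> cube 4. star_at P a i j k} \<le> 1")
  case True
  then obtain i j k l where \<rho>: "[i, j, k, l] \<in> directions 4 4" and "\<not> card {a \<in> cube 4. star_at P a i j k} \<le> 1"
    by blast
  then obtain a b where a: "a \<in> cube 4" "star_at P a i j k" and b: "b \<in> cube 4" "star_at P b i j k" "b \<noteq> a"
    by (auto simp: card_le_Suc0_iff_eq)
  define Q where "Q = pattern P a [i, j, k, l]"
  have star_Q: "star_at Q c 0 1 2 \<longleftrightarrow> star_at P (embed a [i, j, k, l] c) i j k" if "c \<in> cube 4" for c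
    unfolding pattern_eq_W8_iff[symmetric] Q_def using that by (subst pattern_pattern) (auto simp: numeral_eq_Suc)
  obtain c where c: "c \<in> cube 4" "b = embed a [i, j, k, l] c"
    using b(1) embed_automorphism[OF a(1) \<rho>] by blast
  then obtain x y z u where xyzu: "c = [x, y, z, u]"
    by (auto simp: cube_def numeral_eq_Suc length_Suc_conv)
  have "star_at Q [False, False, False, False] 0 1 2"
    using a star_Q[of "[False, False, False, False]"] by (simp add: cube_def)
  moreover have "star_at Q [x, y, z, u] 0 1 2" using star_Q[OF c(1)] b(2) c(2) xyzu by simp
  moreover have "x \<or> y \<or> z \<or> u" using b(3) c(2) by (cases x; cases y; cases z; cases u) (simp_all add: xyzu)
  ultimately have "symmetrize 4 star_functional Q \<le> 768" by (rule symmetrize_star_functional_opposite)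
  then show ?thesis unfolding Q_def symmetrize_pattern[OF a(1) \<rho>] .
next
  case False
  have "(\<Sum>a\<in>cube 4. star_functional (pattern P a \<rho>)) \<le> 32" if "\<rho> \<in> directions 4 4" for \<rho>
  proof -
    have "length \<rho> = 4" using that by (simp add: directions_def)
    then obtain i j k l where \<rho>: "\<rho> = [i, j, k, l]" by (auto simp: numeral_eq_Suc length_Suc_conv)
    then have "card {a \<in> cube 4. star_at P a i j k} \<le> 1" using False that by blast
    then show ?thesis unfolding \<rho> by (rule sum_star_functional_le)
  qed
  then have "(\<Sum>\<rho>\<in>directions 4 4. \<Sum>a\<in>cube 4. star_functional (pattern P a \<rho>)) \<le> (\<Sum>\<rho>\<in>directions 4 4. 32)"
    by (rule sum_mono)
  then show ?thesis
    unfolding symmetrize_def by (subst sum.swap) (simp add: card_directions fact_numeral)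
qed

lemma automorphism_count_W8: "automorphism_count 3 W8 = 6"
  unfolding automorphism_count_def symmetrize_def sum_cube_3 sum_directions_3 pattern_eq_W8_iff
  by (simp add: star_at_def flip_list3 W8_def del: One_nat_def)

lemma copy_density_le_W8: "copy_density_le 3 W8 (2 / 3)"
proof -
  have "copy_density_le 3 W8 (2 * (2 ^ 3 * fact 3) / (24 * automorphism_count 3 W8))"
  proof (rule copy_density_le_certificate[where m = 4 and h = "\<lambda>P. 4 * square 2 star_difference P"])
    show "0 \<le> pattern_sum 4 n S (\<lambda>P. 4 * square 2 star_difference P)" for n S
      using pattern_sum_square_nonneg[of 2 n S star_difference] by (simp add: pattern_sum_cmult)
    show "symmetrize 4 (\<lambda>P. 24 * of_bool (pattern P (origin 4) [0..<3] = W8) + 4 * square 2 star_difference P) P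
        \<le> 2 * (2 ^ 4 * fact 4)" for P
      using symmetrize_star_functional_le[of P] by (simp add: star_functional_def[abs_def] fact_numeral)
  qed (simp_all add: W_subset_cube)
  then show ?thesis by (simp add: automorphism_count_W8 fact_numeral)
qed

section \<open>Lower bounds\<close>

definition cluster :: "bool \<Rightarrow> bool \<Rightarrow> bool list \<Rightarrow> nat set \<Rightarrow> bool list set" where
  "cluster p q x I = (if p then {x} else {}) \<union> (if q then {map Not x} else {}) \<union> (\<lambda>i. flip i x) ` I"

lemma cluster_subset_cube: "x \<in> cube d \<Longrightarrow> cluster p q x I \<subseteq> cube d"
  by (auto simp: cluster_def cube_def)

lemma cluster_in_copies:
  assumes x: "x \<in> cube d" and "I \<subseteq> {..<d}" "J \<subseteq> {..<d}" "card I = card J"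
  shows "cluster p q x I \<in> copies d (cluster p q (origin d) J)"
proof -
  obtain \<rho> where \<rho>: "\<rho> \<in> directions d d" "(!) \<rho> ` J = I" using directions_mapping_onto assms(2-4) by metis
  have "embed x \<rho> (flip i (origin d)) = flip (\<rho> ! i) x" if "i \<in> J" for i
    using that assms(3) \<rho>(1) by (auto simp: embed_flip directions_def)
  then have "embed x \<rho> ` cluster p q (origin d) J = cluster p q x ((!) \<rho> ` J)"
    using embed_ones[OF x \<rho>(1)] by (simp add: cluster_def image_Un image_image)
  moreover have "embed x \<rho> ` cluster p q (origin d) J \<in> copies d (cluster p q (origin d) J)"
    by (rule image_embed_in_copies[OF cluster_subset_cube x \<rho>(1)]) simp
  ultimately show ?thesis by (simp add: \<rho>(2))
qed

lemma W_eq_cluster: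
  "W7 = cluster True True (origin 3) {}"
  "W8 = cluster False False (origin 3) {..<3}"
  "W9 = cluster True True (origin 3) {1, 2}"
  "W10 = cluster True True (origin 3) {2}"
  "W12 = cluster True False (origin 3) {..<3}"
  by (auto simp: W7_def W8_def W9_def W10_def W12_def cluster_def numeral_3_eq_3 numeral_2_eq_2 lessThan_Suc)

lemma bij_betw_add_mod:
  assumes "0 < (m :: nat)"
  shows "bij_betw (\<lambda>s. (s + k) mod m) {..<m} {..<m}"
proof -
  have "(s + k) mod m \<noteq> (t + k) mod m" if "s < t" "t < m" for s t
    using that mod_eq_dvd_iff_nat[of "s + k" "t + k" m] by (auto dest: dvd_imp_le)
  then have "inj_on (\<lambda>s. (s + k) mod m) {..<m}"
    by (intro linorder_inj_onI) auto
  moreover have "(\<lambda>s. (s + k) mod m) ` {..<m} \<subseteq> {..<m}" using assms by auto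
  ultimately show ?thesis by (simp add: bij_betw_def endo_inj_surj)
qed

definition cyclic_step :: "nat \<Rightarrow> ('a \<Rightarrow> nat) \<Rightarrow> 'a \<Rightarrow> nat \<Rightarrow> nat" where
  "cyclic_step m weight a s = (s + weight a) mod m"

lemma commuting_cyclic_step: "commuting (cyclic_step m u)"
  by (simp add: commuting_def cyclic_step_def mod_simps add_ac)

lemma bij_betw_cyclic_step: "0 < m \<Longrightarrow> bij_betw (cyclic_step m u a) {..<m} {..<m}"
  using bij_betw_add_mod by (simp add: cyclic_step_def[abs_def])

lemma ind_ratio_ge_layered:
  assumes "H \<subseteq> cube d" "d \<le> n" "0 < m" and B: "B \<subseteq> {..<m}"
    and copy: "\<And>s. s \<in> B \<Longrightarrow> colouring (cyclic_step m (\<lambda>_. 1)) F (replicate d ()) s \<in> copies d H"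
  shows "real (card B) / real m \<le> ind_ratio d H n"
proof -
  have "card B \<le> card {s \<in> {..<m}. colouring (cyclic_step m (\<lambda>_. 1)) F w s \<in> copies d H}"
    if "w \<in> words {()} d" for w
  proof -
    have "w = replicate d ()" using that by (intro replicate_eqI) (auto simp: words_def)
    then show ?thesis using B copy by (intro card_mono) auto
  qed
  then have "real (card (words {()} d) * card B) / real (card {()} ^ d * card {..<m}) \<le> ind_ratio d H n"
    using assms(1-3)
    by (intro ind_ratio_ge_colouring[of H d n _ _ "cyclic_step m (\<lambda>_. 1)"]
        commuting_cyclic_step bij_betw_cyclic_step) auto
  then show ?thesis by (simp add: card_words)
qed

lemma cube_code [code]: "cube n = set (List.n_lists n [False, True])"
  by (auto simp: cube_def set_n_lists)

lemma colouring_code [code]: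
  "colouring f F w s = set (filter (\<lambda>v. act_on f s w v \<in> F) (List.n_lists (length w) [False, True]))"
  by (auto simp: colouring_def cube_code)

lemma ind_ratio_W7_ge:
  assumes "3 \<le> n"
  shows "1 / 3 \<le> ind_ratio 3 W7 n"
proof -
  have "colouring (cyclic_step 3 (\<lambda>_. 1)) {0} (replicate 3 ()) 0 = cluster True True (origin 3) {}"
    by code_simp
  then have "colouring (cyclic_step 3 (\<lambda>_. 1)) {0} (replicate 3 ()) 0 \<in> copies 3 W7"
    unfolding W_eq_cluster by (simp add: cluster_in_copies)
  then show ?thesis using ind_ratio_ge_layered[of W7 3 n 3 "{0}" "{0}"] assms by (simp add: W_subset_cube)
qed

lemma ind_ratio_W8_ge:
  assumes "3 \<le> n"
  shows "2 / 3 \<le> ind_ratio 3 W8 n"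
proof -
  have "colouring (cyclic_step 3 (\<lambda>_. 1)) {0} (replicate 3 ()) 1 = cluster False False (replicate 3 True) {..<3}"
    "colouring (cyclic_step 3 (\<lambda>_. 1)) {0} (replicate 3 ()) 2 = cluster False False (origin 3) {..<3}"
    by code_simp+
  then have "colouring (cyclic_step 3 (\<lambda>_. 1)) {0} (replicate 3 ()) s \<in> copies 3 W8" if "s \<in> {1, 2}" for s
    unfolding W_eq_cluster using that by (auto intro!: cluster_in_copies simp: cube_def)
  then show ?thesis using ind_ratio_ge_layered[of W8 3 n 3 "{1, 2}" "{0}"] assms by (simp add: W_subset_cube)
qed

lemma ind_ratio_W12_ge:
  assumes "3 \<le> n"
  shows "1 / 2 \<le> ind_ratio 3 W12 n"
proof -
  have "colouring (cyclic_step 4 (\<lambda>_. 1)) {0, 1} (replicate 3 ()) 0 = cluster True False (origin 3) {..<3}"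
    "colouring (cyclic_step 4 (\<lambda>_. 1)) {0, 1} (replicate 3 ()) 2 = cluster True False (replicate 3 True) {..<3}"
    by code_simp+
  then have "colouring (cyclic_step 4 (\<lambda>_. 1)) {0, 1} (replicate 3 ()) s \<in> copies 3 W12" if "s \<in> {0, 2}" for s
    unfolding W_eq_cluster using that by (auto intro!: cluster_in_copies simp: cube_def)
  then show ?thesis using ind_ratio_ge_layered[of W12 3 n 4 "{0, 2}" "{0, 1}"] assms by (simp add: W_subset_cube)
qed

definition antipodal_cluster :: "nat \<Rightarrow> nat \<Rightarrow> bool list set \<Rightarrow> bool" where
  "antipodal_cluster d k P \<longleftrightarrow> card P = k + 2 \<and>
    (\<exists>x\<in>P. map Not x \<in> P \<and> length (filter (\<lambda>i. flip i x \<in> P) [0..<d]) = k)"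

lemma card_antipodal_pair_cluster:
  assumes "3 \<le> length x" and I: "I \<subseteq> {..<length x}"
  shows "card (cluster True True x I) = card I + 2"
proof -
  have "inj_on (\<lambda>i. flip i x) I" using inj_on_flip I by (rule inj_on_subset)
  then have "card ((\<lambda>i. flip i x) ` I) = card I" by (rule card_image)
  moreover have "x \<notin> (\<lambda>i. flip i x) ` I" using I flip_neq by (metis imageE lessThan_iff subsetD)
  moreover have "map Not x \<noteq> flip i x" for i
  proof -
    have "\<exists>m<length x. m \<noteq> i" using assms(1) by (cases "i = 0") (auto intro: exI[of _ 0] exI[of _ 1])
    then show ?thesis using nth_flip nth_map by metis
  qed
  moreover have "x \<noteq> map Not x" using assms(1) by (cases x) simp_all
  moreover have "finite I" using I finite_subset by blast
  ultimately show ?thesis by (subst cluster_def) (auto simp: card_insert_if image_iff)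
qed

lemma antipodal_cluster_in_copies:
  assumes P: "P \<subseteq> cube d" and "3 \<le> d" "J \<subseteq> {..<d}" and cluster: "antipodal_cluster d (card J) P"
  shows "P \<in> copies d (cluster True True (origin d) J)"
proof -
  obtain x where x: "x \<in> P" "map Not x \<in> P" and J: "length (filter (\<lambda>i. flip i x \<in> P) [0..<d]) = card J"
      and card_P: "card P = card J + 2"
    using cluster by (auto simp: antipodal_cluster_def)
  define I where "I = {i. i < d \<and> flip i x \<in> P}"
  have x_cube: "x \<in> cube d" "length x = d" using x P by (auto simp: cube_def)
  have card_I: "card I = card J"
    unfolding J[symmetric] length_filter_conv_card I_def by (rule arg_cong[of _ _ card]) auto
  have I: "I \<subseteq> {..<d}" by (auto simp: I_def)
  have "cluster True True x I \<subseteq> P" using x by (auto simp: cluster_def I_def)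
  moreover have "card (cluster True True x I) = card P"
    using card_antipodal_pair_cluster[of x I] x_cube I \<open>3 \<le> d\<close> by (simp add: card_I card_P)
  moreover have "finite P" using finite_subset[OF P] by simp
  ultimately have "P = cluster True True x I" by (metis card_subset_eq)
  then show ?thesis using cluster_in_copies[OF x_cube(1) I assms(3) card_I] by simp
qed

lemma length_filter_antipodal_cluster_le:
  assumes "distinct states" "length w = d" "3 \<le> d" "J \<subseteq> {..<d}"
  shows "length (filter (antipodal_cluster d (card J)) (map (colouring f F w) states)) \<le>
    card {s \<in> set states. colouring f F w s \<in> copies d (cluster True True (origin d) J)}"
proof -
  have "length (filter (antipodal_cluster d (card J)) (map (colouring f F w) states)) =
      card {s \<in> set states. antipodal_cluster d (card J) (colouring f F w s)}"
    using distinct_length_filter[OF assms(1)] by (simp add: filter_map comp_def Int_def conj_commute)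
  also have "\<dots> \<le> card {s \<in> set states. colouring f F w s \<in> copies d (cluster True True (origin d) J)}"
    using assms(2-4) by (intro card_mono) (auto intro!: antipodal_cluster_in_copies simp: colouring_def)
  finally show ?thesis .
qed

definition weight_W9 :: "nat \<Rightarrow> nat" where
  "weight_W9 i = (if i = 0 then 2 else 1)"

lemma ind_ratio_W9_ge:
  assumes "3 \<le> n"
  shows "4 / 9 \<le> ind_ratio 3 W9 n"
proof -
  let ?f = "cyclic_step 4 weight_W9"
  define W where "W = filter (\<lambda>w. count_list w 0 = 1) (List.n_lists 3 [0..<3])"
  have four_copies: "list_all (\<lambda>w. 4 \<le> length (filter (antipodal_cluster 3 2) (map (colouring ?f {0, 1} w) [0..<4]))) W"
    unfolding W_def by code_simp
  have W: "set W \<subseteq> words {..<3} 3"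
    by (auto simp: W_def words_def set_n_lists)
  have "4 \<le> card {s \<in> {..<4}. colouring ?f {0, 1} w s \<in> copies 3 W9}" if w: "w \<in> set W" for w
  proof -
    have "length w = 3" using w W by (auto simp: words_def)
    then show ?thesis
      using four_copies w length_filter_antipodal_cluster_le[of "[0..<4]" w 3 "{1, 2}" ?f "{0, 1}"]
      by (simp add: list_all_iff W_eq_cluster atLeast0LessThan numeral_2_eq_2) (meson order_trans)
  qed
  then have "real (card (set W) * 4) / real (card {..<3 :: nat} ^ 3 * card {..<4 :: nat}) \<le> ind_ratio 3 W9 n"
    using assms W by (intro ind_ratio_ge_colouring[of W9 3 n _ _ ?f] commuting_cyclic_step bij_betw_cyclic_step)
      (auto simp: W_subset_cube lessThan_empty_iff)
  moreover have "card (set W) = 12" unfolding W_def by code_simp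
  ultimately show ?thesis by simp
qed

lemma colouring_permute:
  assumes "commuting f" and perm: "mset w' = mset w"
    and copy: "colouring f F w s \<in> copies (length w) H"
  shows "colouring f F w' s \<in> copies (length w) H"
proof -
  let ?d = "length w"
  have len: "length w' = ?d" using perm by (rule mset_eq_length)
  obtain p where p: "p permutes {..<length w'}" "permute_list p w' = w"
    using mset_eq_permutation[OF perm[symmetric]] by blast
  define \<rho> where "\<rho> = map p [0..<?d]"
  have \<rho>: "\<rho> \<in> directions ?d ?d"
    using p(1) permutes_inj_on[OF p(1)] permutes_image[OF p(1)]
    by (auto simp: \<rho>_def directions_def distinct_map len lessThan_atLeast0)
  have "map ((!) w') \<rho> = w" using p(2) by (simp add: \<rho>_def permute_list_def len comp_def)
  then have "pattern (colouring f F w' s) (origin ?d) \<rho> = colouring f F w s"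
    using len \<rho> by (subst pattern_colouring[OF \<open>commuting f\<close>]) (auto simp: cube_def directions_set_eq)
  then show ?thesis
    using copy copies_of_pattern[OF _ origin_in_cube \<rho>, of "colouring f F w' s" H]
    by (simp add: colouring_def len)
qed

text \<open>
  The 5-cube with the map Not as a sixth direction is the 6-cube modulo its antipodal map. In terms of a pentagon on the
  first five directions, the code consists of the empty set, the edges, and the complements of both the empty set and
  the non-edges.
\<close>

definition folded_flip :: "nat \<Rightarrow> bool list \<Rightarrow> bool list" where
  "folded_flip i s = (if i < 5 then flip i s else map Not s)"

definition pentagon_code :: "bool list set" where
  "pentagon_code = {[False, False, False, False, False], [True, True, True, True, True],
    [True, True, False, False, False], [False, True, True, False, False], [False, False, True, True, False],
    [False, False, False, True, True], [True, False, False, False, True],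
    [True, True, False, True, False], [True, False, True, False, True], [False, True, False, True, True],
    [True, False, True, True, False], [False, True, True, False, True]}"

lemma commuting_folded_flip: "commuting folded_flip"
proof -
  have "flip i (map Not s) = map Not (flip i s)" for i s
    by (rule nth_equalityI) (auto simp: nth_flip)
  then show ?thesis by (simp add: commuting_def folded_flip_def flip_commute)
qed

lemma bij_betw_folded_flip: "bij_betw (folded_flip a) (cube n) (cube n)"
  by (rule bij_betw_byWitness[where f' = "folded_flip a"]) (auto simp: folded_flip_def cube_def comp_def)

lemma pentagon_code_sorted:
  "list_all (\<lambda>w. 24 \<le> length (filter (antipodal_cluster 3 1)
    (map (colouring folded_flip pentagon_code w) (List.n_lists 5 [False, True]))))
    (filter (sorted_wrt (<)) (List.n_lists 3 [0..<6]))"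
  by code_simp

lemma card_pentagon_copies:
  assumes w: "w \<in> directions 6 3"
  shows "24 \<le> card {s \<in> cube 5. colouring folded_flip pentagon_code w s \<in> copies 3 W10}"
proof -
  have len: "length w = 3" using w by (simp add: directions_def)
  have "sort w \<in> set (filter (sorted_wrt (<)) (List.n_lists 3 [0..<6]))"
    using w by (auto simp: directions_def set_n_lists strict_sorted_iff)
  then have "24 \<le> length (filter (antipodal_cluster 3 1)
      (map (colouring folded_flip pentagon_code (sort w)) (List.n_lists 5 [False, True])))"
    using pentagon_code_sorted by (simp only: list_all_iff)
  also have "\<dots> \<le> card {s \<in> cube 5. colouring folded_flip pentagon_code (sort w) s \<in> copies 3 W10}"
    using length_filter_antipodal_cluster_le[of "List.n_lists 5 [False, True]" "sort w" 3 "{2}"]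
    by (simp add: len distinct_n_lists W_eq_cluster cube_code)
  also have "\<dots> \<le> card {s \<in> cube 5. colouring folded_flip pentagon_code w s \<in> copies 3 W10}"
    using colouring_permute[OF commuting_folded_flip, of w "sort w"] len
    by (intro card_mono) (auto simp: cube_code)
  finally show ?thesis .
qed

lemma ind_ratio_W10_ge:
  assumes "3 \<le> n"
  shows "5 / 12 \<le> ind_ratio 3 W10 n"
proof -
  have "cube 5 \<noteq> {}" using origin_in_cube by blast
  then have "real (card (directions 6 3) * 24) / real (card {..<6 :: nat} ^ 3 * card (cube 5)) \<le> ind_ratio 3 W10 n"
    using assms directions_subset_words card_pentagon_copies
    by (intro ind_ratio_ge_colouring[of W10 3 n _ _ folded_flip] commuting_folded_flip bij_betw_folded_flip)
      (auto simp: W_subset_cube lessThan_empty_iff)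
  then show ?thesis by (simp add: card_directions card_cube fact_numeral numeral_eq_Suc)
qed

theorem theorem1p1:
  shows "ind_ratio 3 W7 \<longlonglongrightarrow> 1/3 \<and>
         ind_ratio 3 W8 \<longlonglongrightarrow> 2/3 \<and>
         ind_ratio 3 W9 \<longlonglongrightarrow> 4/9 \<and>
         ind_ratio 3 W10 \<longlonglongrightarrow> 5/12 \<and>
         ind_ratio 3 W12 \<longlonglongrightarrow> 1/2"
proof (intro conjI)
  show "ind_ratio 3 W7 \<longlonglongrightarrow> 1/3"
    by (rule ind_ratio_tendsto[OF copy_density_le_W7 ind_ratio_W7_ge])
  show "ind_ratio 3 W8 \<longlonglongrightarrow> 2/3"
    by (rule ind_ratio_tendsto[OF copy_density_le_W8 ind_ratio_W8_ge])
  show "ind_ratio 3 W9 \<longlonglongrightarrow> 4/9"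
    by (rule ind_ratio_tendsto[OF copy_density_le_W9 ind_ratio_W9_ge])
  show "ind_ratio 3 W10 \<longlonglongrightarrow> 5/12"
    by (rule ind_ratio_tendsto[OF copy_density_le_W10 ind_ratio_W10_ge])
  show "ind_ratio 3 W12 \<longlonglongrightarrow> 1/2"
    by (rule ind_ratio_tendsto[OF copy_density_le_W12 ind_ratio_W12_ge])
qed

end
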